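(* Let $n\ge 1$ and $k\ge 2$ be integers. The maps $\xi\colon \mathrm{JD}(n,k)\to S_n^{k-1}$ and $\eta\colon S_n^{k-1}\to \mathrm{JD}(n,k)$ are reciprocal (mutually inverse) bijections between $\mathrm{JD}(n,k)$ and $S_n^{k-1}$.
   Context: Lattice notions. $x\prec y$ denotes the covering relation. The length of an $(n+1)$-element chain is $n$; the length of a lattice is the supremum of lengths of its chains. A lattice is semimodular if $x\prec y$ implies $x\vee z\preceq y\vee z$ for all $x,y,z$ (where $\preceq$ means $\prec$ or $=$). It is meet-semidistributive if $x\wedge y=x\wedge z$ implies $x\wedge y=x\wedge(y\vee z)$. A finite lattice is join-distributive if it is semimodular and meet-semidistributive. $\mathrm{Ji}\,L$ is the set of join-irreducible elements of $L$ (elements with exactly one lower cover; $0$ is excluded). Join-distributive lattices contain no cover-preserving diamond (a cover-preserving diamond is a 5-element sublattice isomorphic to $M_3$ whose covering pairs are covering pairs in $L$). The class $\mathrm{JD}(n,k)$ consists of the isomorphism classes $\mathbf I\langle L;C_1,\dots,C_k\rangle$ of systems where $L$ is a join-distributive lattice of length $n$ and $C_1,\dots,C_k$ are maximal chains of $L$ with $\mathrm{Ji}\,L\subseteq C_1\cup\dots\cup C_k$. (An isomorphism of systems is a lattice isomorphism mapping the $i$-th chain onto the $i$-th chain for every $i$.) Trajectories. A prime interval is a 2-element interval. A covering square of $L$ is a cover-preserving 4-element boolean sublattice $\{a\wedge b,a,b,a\vee b\}$; the prime intervals $[a\wedge b,a]$ and $[b,a\vee b]$ are opposite sides of it, and so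 are $[a\wedge b,b]$ and $[a,a\vee b]$. Two prime intervals are consecutive if they are opposite sides of the same covering square. The blocks of the reflexive transitive closure of consecutiveness (an equivalence relation on the set of prime intervals) are the trajectories of $L$. Jordan–Hölder permutations. For maximal chains $C=\{0=c_0\prec\dots\prec c_n=1\}$ and $D=\{0=d_0\prec\dots\prec d_n=1\}$ of $L$, the permutation $\pi_{CD}$ of $\{1,\dots,n\}$ is defined by $\pi_{CD}(i)=j$ iff $[c_{i-1},c_i]$ and $[d_{j-1},d_j]$ belong to the same trajectory of $L$. The map $\xi$. $S_n$ is the group of permutations of $\{1,\dots,n\}$, and $$\xi(\mathbf I\langle L;C_1,\dots,C_k\rangle)=\langle \pi_{C_1C_2},\pi_{C_1C_3},\dots,\pi_{C_1C_k}\rangle .$$ The map $\eta$. Let $\vec\pi=\langle\pi_{12},\dots,\pi_{1k}\rangle\in S_n^{k-1}$, put $\pi_{11}=\mathrm{id}$ and $\pi_{ij}=\pi_{1j}\circ\pi_{1i}^{-1}$ for $i,j\in\{1,\dots,k\}$ (composition from right to left). An eligible $\vec\pi$-tuple is $\vec x=\langle x_1,\dots,x_k\rangle\in\{0,1,\dots,n\}^k$ such that $\pi_{ij}(x_i+1)\ge x_j+1$ for all $i,j\in\{1,\dots,k\}$ with $x_i<n$. $L(\vec\pi)$ is the set of eligible $\vec\pi$-tuples ordered componentwise. An eligible tuple $\vec x$ is initial in its $i$-th component if for all $\vec y\in L(\vec\pi)$, $x_i=y_i$ implies $\vec x\le\vec y$; $C_i(\vec\pi)$ is the set of eligible tuples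 that are initial in their $i$-th component. Then $$\eta(\vec\pi)=\mathbf I\langle L(\vec\pi);C_1(\vec\pi),\dots,C_k(\vec\pi)\rangle .$$ *)

theory Defs
  imports
    "HOL-Algebra.Lattice"
    "HOL-Combinatorics.Permutations"
    "HOL-Library.FuncSet"
    "HOL-Library.Extended_Nat"
begin

section \<open>Lattice notions\<close>

definition covers :: "'a gorder \<Rightarrow> 'a \<Rightarrow> 'a \<Rightarrow> bool" where
  "covers L x y \<longleftrightarrow> x \<in> carrier L \<and> y \<in> carrier L \<and> x \<sqsubset>\<^bsub>L\<^esub> y \<and>
     \<not> (\<exists>z\<in>carrier L. x \<sqsubset>\<^bsub>L\<^esub> z \<and> z \<sqsubset>\<^bsub>L\<^esub> y)"

abbreviation chain_in :: "'a gorder \<Rightarrow> 'a set \<Rightarrow> bool" where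
  "chain_in L \<equiv> pred_on.chain (carrier L) (lless L)"

abbreviation maximal_chain :: "'a gorder \<Rightarrow> 'a set \<Rightarrow> bool" where
  "maximal_chain L \<equiv> pred_on.maxchain (carrier L) (lless L)"

text \<open>An infinite chain has finite subchains of every size, so the supremum over the finite
  nonempty chains is the supremum over all chains.\<close>
definition lattice_length :: "'a gorder \<Rightarrow> enat" where
  "lattice_length L = (SUP C \<in> {C. chain_in L C \<and> finite C \<and> C \<noteq> {}}. enat (card C - 1))"

definition semimodular :: "'a gorder \<Rightarrow> bool" where
  "semimodular L \<longleftrightarrow>
     (\<forall>x\<in>carrier L. \<forall>y\<in>carrier L. \<forall>z\<in>carrier L. covers L x y \<longrightarrow>
        covers L (x \<squnion>\<^bsub>L\<^esub> z) (y \<squnion>\<^bsub>L\<^esub> z) \<or> x \<squnion>\<^bsub>L\<^esub> z = y \<squnion>\<^bsub>L\<^esub> z)"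

definition meet_semidistributive :: "'a gorder \<Rightarrow> bool" where
  "meet_semidistributive L \<longleftrightarrow>
     (\<forall>x\<in>carrier L. \<forall>y\<in>carrier L. \<forall>z\<in>carrier L.
        x \<sqinter>\<^bsub>L\<^esub> y = x \<sqinter>\<^bsub>L\<^esub> z \<longrightarrow> x \<sqinter>\<^bsub>L\<^esub> y = x \<sqinter>\<^bsub>L\<^esub> (y \<squnion>\<^bsub>L\<^esub> z))"

definition join_distributive :: "'a gorder \<Rightarrow> bool" where
  "join_distributive L \<longleftrightarrow>
     lattice L \<and> finite (carrier L) \<and> semimodular L \<and> meet_semidistributive L"

definition Ji :: "'a gorder \<Rightarrow> 'a set" where
  "Ji L = {x \<in> carrier L. \<exists>!y. covers L y x}"


section \<open>Systems and their isomorphism classes\<close>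

text \<open>A system \<open>\<langle>L; C\<^sub>1, \<dots>, C\<^sub>k\<rangle>\<close> is a pair \<open>(L, C)\<close>; only the values \<open>C 1, \<dots>, C k\<close> are
  meaningful, and all notions below ignore the other ones.\<close>
type_synonym 'a chain_system = "'a gorder \<times> (nat \<Rightarrow> 'a set)"

definition JD_system :: "nat \<Rightarrow> nat \<Rightarrow> 'a chain_system \<Rightarrow> bool" where
  "JD_system n k = (\<lambda>(L, C).
     join_distributive L \<and> lattice_length L = enat n \<and>
     (\<forall>i\<in>{1..k}. maximal_chain L (C i)) \<and> Ji L \<subseteq> (\<Union>i\<in>{1..k}. C i))"

definition lattice_iso :: "'a gorder \<Rightarrow> 'b gorder \<Rightarrow> ('a \<Rightarrow> 'b) \<Rightarrow> bool" where
  "lattice_iso L M f \<longleftrightarrow> lattice L \<and> lattice M \<and> bij_betw f (carrier L) (carrier M) \<and>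
     (\<forall>x\<in>carrier L. \<forall>y\<in>carrier L.
        f (x \<squnion>\<^bsub>L\<^esub> y) = f x \<squnion>\<^bsub>M\<^esub> f y \<and> f (x \<sqinter>\<^bsub>L\<^esub> y) = f x \<sqinter>\<^bsub>M\<^esub> f y)"

definition isomorphic_systems :: "nat \<Rightarrow> 'a chain_system \<Rightarrow> 'b chain_system \<Rightarrow> bool" where
  "isomorphic_systems k = (\<lambda>(L, C) (M, D).
     \<exists>f. lattice_iso L M f \<and> (\<forall>i\<in>{1..k}. f ` C i = D i))"

text \<open>Isomorphism classes are formed inside a universe type \<open>'a\<close>: the class of a system over
  any type \<open>'b\<close> is the set of its isomorphic copies over \<open>'a\<close>. If \<open>'a\<close> is infinite, every
  finite system has such a copy, so the classes over \<open>'a\<close> represent all isomorphism types.\<close>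
definition iso_class :: "nat \<Rightarrow> 'b chain_system \<Rightarrow> 'a chain_system set" where
  "iso_class k S = {T. isomorphic_systems k S T}"

definition JD :: "nat \<Rightarrow> nat \<Rightarrow> 'a chain_system set set" where
  "JD n k = {iso_class k S | S :: 'a chain_system. JD_system n k S}"


section \<open>Trajectories and Jordan--Hoelder permutations\<close>

text \<open>The prime interval \<open>[a, b]\<close> is represented by the pair \<open>(a, b)\<close>.\<close>
definition prime_intervals :: "'a gorder \<Rightarrow> ('a \<times> 'a) set" where
  "prime_intervals L = {(a, b). covers L a b}"

text \<open>The covers \<open>a \<sqinter> b \<prec> a\<close> and \<open>a \<sqinter> b \<prec> b\<close> already force \<open>a\<close> and \<open>b\<close> to be incomparable,
  so \<open>{a \<sqinter> b, a, b, a \<squnion> b}\<close> is a four-element boolean sublattice.\<close>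
definition covering_square :: "'a gorder \<Rightarrow> 'a \<Rightarrow> 'a \<Rightarrow> bool" where
  "covering_square L a b \<longleftrightarrow> a \<in> carrier L \<and> b \<in> carrier L \<and>
     covers L (a \<sqinter>\<^bsub>L\<^esub> b) a \<and> covers L (a \<sqinter>\<^bsub>L\<^esub> b) b \<and>
     covers L a (a \<squnion>\<^bsub>L\<^esub> b) \<and> covers L b (a \<squnion>\<^bsub>L\<^esub> b)"

text \<open>The other pair of opposite sides arises by exchanging \<open>a\<close> and \<open>b\<close>.\<close>
definition consecutive :: "'a gorder \<Rightarrow> (('a \<times> 'a) \<times> ('a \<times> 'a)) set" where
  "consecutive L = {(p, q). \<exists>a b. covering_square L a b \<and>
     {p, q} = {(a \<sqinter>\<^bsub>L\<^esub> b, a), (b, a \<squnion>\<^bsub>L\<^esub> b)}}"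

definition trajectories :: "'a gorder \<Rightarrow> ('a \<times> 'a) set set" where
  "trajectories L = prime_intervals L // (consecutive L)\<^sup>*"

text \<open>The element \<open>c\<^sub>i\<close> of a finite chain \<open>C = {c\<^sub>0 \<prec> c\<^sub>1 \<prec> \<dots>}\<close>.\<close>
definition chain_elem :: "'a gorder \<Rightarrow> 'a set \<Rightarrow> nat \<Rightarrow> 'a" where
  "chain_elem L C i = (THE c. c \<in> C \<and> card {x \<in> C. x \<sqsubset>\<^bsub>L\<^esub> c} = i)"

definition chain_interval :: "'a gorder \<Rightarrow> 'a set \<Rightarrow> nat \<Rightarrow> 'a \<times> 'a" where
  "chain_interval L C i = (chain_elem L C (i - 1), chain_elem L C i)"

definition JH_perm :: "nat \<Rightarrow> 'a gorder \<Rightarrow> 'a set \<Rightarrow> 'a set \<Rightarrow> nat \<Rightarrow> nat" where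
  "JH_perm n L C D = (THE p. p permutes {1..n} \<and>
     (\<forall>i\<in>{1..n}. \<forall>j\<in>{1..n}. p i = j \<longleftrightarrow>
        (\<exists>T\<in>trajectories L. chain_interval L C i \<in> T \<and> chain_interval L D j \<in> T)))"


section \<open>The maps\<close>

text \<open>The tuple \<open>\<langle>\<pi>\<^sub>1\<^sub>2, \<dots>, \<pi>\<^sub>1\<^sub>k\<rangle>\<close> is an extensional function on \<open>{2..k}\<close>.\<close>
definition perm_tuples :: "nat \<Rightarrow> nat \<Rightarrow> (nat \<Rightarrow> nat \<Rightarrow> nat) set" where
  "perm_tuples n k = {2..k} \<rightarrow>\<^sub>E {p. p permutes {1..n}}"

definition system_perms :: "nat \<Rightarrow> nat \<Rightarrow> 'a chain_system \<Rightarrow> (nat \<Rightarrow> nat \<Rightarrow> nat)" where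
  "system_perms n k = (\<lambda>(L, C). \<lambda>j\<in>{2..k}. JH_perm n L (C 1) (C j))"

text \<open>Evaluated at an arbitrary representative of the class.\<close>
definition xi :: "nat \<Rightarrow> nat \<Rightarrow> 'a chain_system set \<Rightarrow> (nat \<Rightarrow> nat \<Rightarrow> nat)" where
  "xi n k X = system_perms n k (SOME S. S \<in> X)"

definition perm1 :: "(nat \<Rightarrow> nat \<Rightarrow> nat) \<Rightarrow> nat \<Rightarrow> nat \<Rightarrow> nat" where
  "perm1 \<pi> j = (if j = 1 then id else \<pi> j)"

definition perm2 :: "(nat \<Rightarrow> nat \<Rightarrow> nat) \<Rightarrow> nat \<Rightarrow> nat \<Rightarrow> nat \<Rightarrow> nat" where
  "perm2 \<pi> i j = perm1 \<pi> j \<circ> inv (perm1 \<pi> i)"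

definition eligible :: "nat \<Rightarrow> nat \<Rightarrow> (nat \<Rightarrow> nat \<Rightarrow> nat) \<Rightarrow> (nat \<Rightarrow> nat) set" where
  "eligible n k \<pi> = {x \<in> {1..k} \<rightarrow>\<^sub>E {0..n}.
     \<forall>i\<in>{1..k}. \<forall>j\<in>{1..k}. x i < n \<longrightarrow> perm2 \<pi> i j (x i + 1) \<ge> x j + 1}"

definition tuple_lattice :: "nat \<Rightarrow> nat \<Rightarrow> (nat \<Rightarrow> nat \<Rightarrow> nat) \<Rightarrow> (nat \<Rightarrow> nat) gorder" where
  "tuple_lattice n k \<pi> =
     \<lparr>carrier = eligible n k \<pi>, eq = (=), le = (\<lambda>x y. \<forall>i\<in>{1..k}. x i \<le> y i)\<rparr>"

definition tuple_chain :: "nat \<Rightarrow> nat \<Rightarrow> (nat \<Rightarrow> nat \<Rightarrow> nat) \<Rightarrow> nat \<Rightarrow> (nat \<Rightarrow> nat) set" where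
  "tuple_chain n k \<pi> i = {x \<in> eligible n k \<pi>.
     \<forall>y\<in>eligible n k \<pi>. x i = y i \<longrightarrow> x \<sqsubseteq>\<^bsub>tuple_lattice n k \<pi>\<^esub> y}"

definition eta :: "nat \<Rightarrow> nat \<Rightarrow> (nat \<Rightarrow> nat \<Rightarrow> nat) \<Rightarrow> 'a chain_system set" where
  "eta n k \<pi> = iso_class k (tuple_lattice n k \<pi>, tuple_chain n k \<pi>)"

end

theory Submission
  imports Defs
begin

text \<open>Read \<open>perm1 \<pi> j\<close> as a linear order on \<open>{1..n}\<close>, in which \<open>e\<close> stands at place \<open>perm1 \<pi> j e\<close>. The
  unions of initial segments of these \<open>k\<close> orders form an antimatroid \<open>F\<close>: the family is closed under
  unions, and if \<open>A \<subset> B\<close> are members then some element of \<open>B - A\<close> can be added to \<open>A\<close> within \<open>F\<close>.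
  A system is \<^emph>\<open>represented\<close> by \<open>\<pi>\<close> (\<open>prefix_representation\<close>) if its lattice is order isomorphic to
  \<open>(F, \<subseteq>)\<close> in such a way that its \<open>j\<close>-th chain becomes the set of initial segments of the \<open>j\<close>-th order.
  The systems represented by \<open>\<pi>\<close> form one isomorphism class \<open>R \<pi>\<close>, and the theorem says that \<open>\<pi> \<mapsto> R \<pi>\<close>
  is what \<open>\<eta>\<close> does, that every class of the right kind is an \<open>R \<pi>\<close>, and that \<open>\<xi>\<close> reads \<open>\<pi>\<close> off from it.

  \<^item> Let \<open>L\<close> be represented. A covering pair of \<open>L\<close> is a pair \<open>A\<close>, \<open>A \<union> {e}\<close>, so it
    carries a label \<open>e\<close>. Joins are unions, and with accessibility this makes \<open>L\<close> join-distributive.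
    Opposite sides of a covering square have equal labels; conversely, an edge labelled \<open>e\<close> can be
    pushed upwards through squares as long as the lower end avoids \<open>e\<close>, so two edges with
    equal labels meet above. Trajectories are therefore label classes (\<open>same_trajectory_iff\<close>). The
    \<open>i\<close>-th edge of the \<open>j\<close>-th chain is labelled by the \<open>i\<close>-th element of the \<open>j\<close>-th order, hence the
    Jordan--Hoelder permutations are the given ones (\<open>representation_system_perms\<close>).

  \<^item> An eligible tuple is a choice of one initial segment from each order such that none of them can be
    lengthened within the union of all of them. Eligible tuples thus correspond to the members
    of \<open>F\<close>, the inverse taking the longest initial segments inside a given set
    (\<open>tuple_system_representation\<close>).

  \<^item> Let \<open>L\<close> be join-distributive with a maximal chain \<open>c\<^sub>0 \<prec> \<dots> \<prec> c\<^sub>n\<close>. Send \<open>x\<close> to the set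
    of all \<open>i\<close> such that joining with \<open>x\<close> collapses the edge from \<open>c\<^sub>i\<^sub>-\<^sub>1\<close> to \<open>c\<^sub>i\<close>. Meet-semidistributivity
    makes this map turn joins into unions (\<open>collapsed_join\<close>). By semimodularity it separates comparable
    elements, hence, as it respects joins, all elements, and every cover adds exactly one element to the
    set (\<open>collapsed_inj_below\<close>, \<open>collapsed_cover\<close>). Every other
    maximal chain then enumerates \<open>{1..n}\<close> in some order, and if the chains contain all
    join-irreducible elements then the image consists of the unions of initial segments
    (\<open>JD_system_representation\<close>).\<close>

section \<open>Lattices represented by antimatroids\<close>

locale antimatroid =
  fixes E :: "'e set" and F :: "'e set set"
  assumes finite_ground: "finite E"
    and feasible_subset: "A \<in> F \<Longrightarrow> A \<subseteq> E"
    and empty_feasible: "{} \<in> F"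
    and union_feasible: "A \<in> F \<Longrightarrow> B \<in> F \<Longrightarrow> A \<union> B \<in> F"
    and accessible: "A \<in> F \<Longrightarrow> B \<in> F \<Longrightarrow> A \<subset> B \<Longrightarrow> \<exists>e\<in>B - A. insert e A \<in> F"
begin

lemma finite_family: "finite F"
  using feasible_subset finite_ground by (meson finite_Pow_iff finite_subset PowI subsetI)

lemma finite_feasible: "A \<in> F \<Longrightarrow> finite A"
  using feasible_subset finite_ground finite_subset by blast

lemma Union_feasible:
  assumes "G \<subseteq> F" shows "\<Union>G \<in> F"
proof -
  have "finite G" using assms finite_family finite_subset by blast
  then show ?thesis using assms
    by (induction G) (auto intro: empty_feasible union_feasible)
qed

text \<open>A maximal feasible set strictly between \<open>A\<close> and \<open>B\<close>, \<open>A\<close> allowed, misses only one element of \<open>B\<close>.\<close>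
lemma coaccessible:
  assumes "A \<in> F" "B \<in> F" "A \<subset> B"
  shows "\<exists>e\<in>B - A. B - {e} \<in> F"
proof -
  let ?G = "{D \<in> F. A \<subseteq> D \<and> D \<subset> B}"
  have "finite ?G" "?G \<noteq> {}" using finite_family assms by auto
  from finite_has_maximal[OF this] obtain D
    where D: "D \<in> ?G" and max: "\<And>D'. D' \<in> ?G \<Longrightarrow> D \<subseteq> D' \<Longrightarrow> D = D'"
    by (elim bexE) simp
  obtain e where e: "e \<in> B - D" "insert e D \<in> F"
    using accessible[of D B] assms D by auto
  have "insert e D = B"
  proof (rule ccontr)
    assume "insert e D \<noteq> B"
    then have "insert e D \<in> ?G" using D e by auto
    then show False using max[of "insert e D"] e by auto
  qed
  then have "B - {e} = D" "e \<in> B - A" using e D by auto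
  then show ?thesis using D by auto
qed

end

text \<open>An order isomorphism \<open>\<phi>\<close> from \<open>L\<close> onto the feasible sets. It is kept as a map between two
  types, so that the lattice of tuples and an abstractly given lattice are both instances.\<close>
locale antimatroid_order = antimatroid E F
  for E :: "'e set" and F :: "'e set set" +
  fixes L :: "'a gorder" (structure) and \<phi> :: "'a \<Rightarrow> 'e set"
  assumes eq_is_identity: "(.=) = (=)"
    and bij_phi: "bij_betw \<phi> (carrier L) F"
    and le_iff: "x \<in> carrier L \<Longrightarrow> y \<in> carrier L \<Longrightarrow> x \<sqsubseteq> y \<longleftrightarrow> \<phi> x \<subseteq> \<phi> y"
begin

lemma phi_feasible: "x \<in> carrier L \<Longrightarrow> \<phi> x \<in> F"
  using bij_phi bij_betwE by blast

lemma phi_eq_iff: "x \<in> carrier L \<Longrightarrow> y \<in> carrier L \<Longrightarrow> \<phi> x = \<phi> y \<longleftrightarrow> x = y"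
  using bij_phi by (metis bij_betw_def inj_on_eq_iff)

lemma feasible_phi:
  assumes "A \<in> F" obtains x where "x \<in> carrier L" "\<phi> x = A"
  using assms bij_phi by (metis bij_betw_iff_bijections)

lemma less_iff: "x \<in> carrier L \<Longrightarrow> y \<in> carrier L \<Longrightarrow> x \<sqsubset> y \<longleftrightarrow> \<phi> x \<subset> \<phi> y"
  using phi_eq_iff by (auto simp: lless_def eq_is_identity le_iff)

lemma finite_carrier: "finite (carrier L)"
  using bij_phi finite_family bij_betw_finite by blast

lemma finite_phi: "x \<in> carrier L \<Longrightarrow> finite (\<phi> x)"
  using phi_feasible finite_feasible by blast

lemma partial_order_L: "partial_order L"
  by unfold_locales (auto simp: eq_is_identity le_iff phi_eq_iff[symmetric])

lemma least_Upper_of_union: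
  assumes "x \<in> carrier L" "y \<in> carrier L" "s \<in> carrier L" "\<phi> s = \<phi> x \<union> \<phi> y"
  shows "least L s (Upper L {x, y})"
proof (rule least_UpperI)
  fix z assume "z \<in> Upper L {x, y}"
  then have "z \<in> carrier L" "x \<sqsubseteq> z" "y \<sqsubseteq> z" using assms by (auto simp: Upper_def)
  then show "s \<sqsubseteq> z" using assms by (auto simp: le_iff)
qed (use assms in \<open>auto simp: le_iff\<close>)

text \<open>The union of all feasible subsets of an intersection is feasible, which provides the meets. A meet
  can be smaller than the intersection.\<close>
lemma lattice_L: "lattice L"
proof -
  interpret partial_order L by (rule partial_order_L)
  show ?thesis
  proof unfold_locales
    fix x y assume xy: "x \<in> carrier L" "y \<in> carrier L"
    obtain s where "s \<in> carrier L" "\<phi> s = \<phi> x \<union> \<phi> y"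
      using xy feasible_phi union_feasible phi_feasible by metis
    then show "\<exists>s. least L s (Upper L {x, y})" using least_Upper_of_union xy by blast
    have "\<Union>{A \<in> F. A \<subseteq> \<phi> x \<inter> \<phi> y} \<in> F" by (rule Union_feasible) auto
    then obtain m where m: "m \<in> carrier L" "\<phi> m = \<Union>{A \<in> F. A \<subseteq> \<phi> x \<inter> \<phi> y}"
      using feasible_phi by metis
    have "greatest L m (Lower L {x, y})"
    proof (rule greatest_LowerI)
      fix z assume "z \<in> Lower L {x, y}"
      then have z: "z \<in> carrier L" "z \<sqsubseteq> x" "z \<sqsubseteq> y" using xy by (auto simp: Lower_def)
      then have "\<phi> z \<subseteq> \<phi> x \<inter> \<phi> y" using xy by (auto simp: le_iff)
      then show "z \<sqsubseteq> m" using m z phi_feasible by (auto simp: le_iff)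
    qed (use xy m in \<open>auto simp: le_iff\<close>)
    then show "\<exists>m. greatest L m (Lower L {x, y})" by blast
  qed
qed

sublocale lattice L by (rule lattice_L)

lemma phi_join:
  assumes "x \<in> carrier L" "y \<in> carrier L"
  shows "\<phi> (x \<squnion> y) = \<phi> x \<union> \<phi> y"
proof -
  obtain s where s: "s \<in> carrier L" "\<phi> s = \<phi> x \<union> \<phi> y"
    using assms feasible_phi union_feasible phi_feasible by metis
  have "x \<squnion> y \<sqsubseteq> s" using s assms by (intro join_le) (auto simp: le_iff)
  moreover have "x \<sqsubseteq> x \<squnion> y" "y \<sqsubseteq> x \<squnion> y" using assms join_left join_right by auto
  ultimately show ?thesis using s assms by (auto simp: le_iff)
qed

lemma phi_meet_iff:
  assumes "x \<in> carrier L" "y \<in> carrier L" "A \<in> F"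
  shows "A \<subseteq> \<phi> (x \<sqinter> y) \<longleftrightarrow> A \<subseteq> \<phi> x \<and> A \<subseteq> \<phi> y"
proof -
  obtain z where z: "z \<in> carrier L" "\<phi> z = A" using assms feasible_phi by metis
  have "z \<sqsubseteq> x \<sqinter> y \<longleftrightarrow> z \<sqsubseteq> x \<and> z \<sqsubseteq> y"
    using z assms meet_le[of z x y] meet_left[of x y] meet_right[of x y]
      le_trans[of z "x \<sqinter> y" x] le_trans[of z "x \<sqinter> y" y] by auto
  then show ?thesis using z assms by (auto simp: le_iff)
qed

lemma phi_meet:
  assumes "x \<in> carrier L" "y \<in> carrier L"
  shows "\<phi> (x \<sqinter> y) = \<Union>{A \<in> F. A \<subseteq> \<phi> x \<inter> \<phi> y}"
  using assms phi_meet_iff[OF assms] phi_feasible[of "x \<sqinter> y"] by auto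

lemma covers_iff:
  "covers L x y \<longleftrightarrow> x \<in> carrier L \<and> y \<in> carrier L \<and> (\<exists>e. e \<notin> \<phi> x \<and> \<phi> y = insert e (\<phi> x))"
proof (intro iffI conjI)
  assume c: "covers L x y"
  then show xy: "x \<in> carrier L" "y \<in> carrier L" by (auto simp: covers_def)
  have "\<phi> x \<subset> \<phi> y" using c xy less_iff by (auto simp: covers_def)
  then obtain e where e: "e \<in> \<phi> y - \<phi> x" "insert e (\<phi> x) \<in> F"
    using accessible phi_feasible xy by metis
  obtain z where z: "z \<in> carrier L" "\<phi> z = insert e (\<phi> x)" using e feasible_phi by metis
  have "\<not> \<phi> z \<subset> \<phi> y" using c z e xy less_iff unfolding covers_def
    by (metis Diff_iff insertI1 psubsetI subset_insertI)
  then show "\<exists>e. e \<notin> \<phi> x \<and> \<phi> y = insert e (\<phi> x)" using e z \<open>\<phi> x \<subset> \<phi> y\<close> by auto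
next
  assume a: "x \<in> carrier L \<and> y \<in> carrier L \<and> (\<exists>e. e \<notin> \<phi> x \<and> \<phi> y = insert e (\<phi> x))"
  then show "covers L x y" unfolding covers_def by (auto simp: less_iff)
qed

text \<open>If \<open>y\<close> has one element \<open>e\<close> more than \<open>x\<close>, then joining both with \<open>z\<close> either absorbs \<open>e\<close> or
  leaves it as the only difference.\<close>
lemma semimodular_L: "semimodular L"
  unfolding semimodular_def
proof (intro ballI impI)
  fix x y z assume c: "x \<in> carrier L" "y \<in> carrier L" "z \<in> carrier L" and "covers L x y"
  then obtain e where e: "e \<notin> \<phi> x" "\<phi> y = insert e (\<phi> x)" by (auto simp: covers_iff)
  show "covers L (x \<squnion> z) (y \<squnion> z) \<or> x \<squnion> z = y \<squnion> z"
  proof (cases "e \<in> \<phi> z")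
    case True
    then have "\<phi> (x \<squnion> z) = \<phi> (y \<squnion> z)" using c e by (auto simp: phi_join)
    then show ?thesis using c phi_eq_iff by simp
  next
    case False
    then show ?thesis using c e by (auto simp: phi_join covers_iff)
  qed
qed

text \<open>If \<open>x \<sqinter> (y \<squnion> z)\<close> were larger than \<open>x \<sqinter> y = x \<sqinter> z\<close>, one could add to the latter a single element
  \<open>e\<close> of the former. As \<open>e\<close> lies in \<open>y\<close> or in \<open>z\<close>, the enlarged set would still be below \<open>x\<close> and one
  of \<open>y\<close>, \<open>z\<close>.\<close>
lemma meet_semidistributive_L: "meet_semidistributive L"
  unfolding meet_semidistributive_def
proof (intro ballI impI, rule ccontr)
  fix x y z assume c: "x \<in> carrier L" "y \<in> carrier L" "z \<in> carrier L"
    and eq: "x \<sqinter> y = x \<sqinter> z" and ne: "x \<sqinter> y \<noteq> x \<sqinter> (y \<squnion> z)"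
  let ?m = "x \<sqinter> y" and ?u = "x \<sqinter> (y \<squnion> z)"
  have A: "A \<subseteq> \<phi> ?m \<longleftrightarrow> A \<subseteq> \<phi> x \<and> A \<subseteq> \<phi> y" "A \<subseteq> \<phi> ?m \<longleftrightarrow> A \<subseteq> \<phi> x \<and> A \<subseteq> \<phi> z"
    "A \<subseteq> \<phi> ?u \<longleftrightarrow> A \<subseteq> \<phi> x \<and> A \<subseteq> \<phi> y \<union> \<phi> z" if "A \<in> F" for A
    using that c phi_meet_iff[of x y A] phi_meet_iff[of x z A] phi_meet_iff[of x "y \<squnion> z" A]
    by (simp_all add: eq phi_join)
  have m: "\<phi> ?m \<in> F" "\<phi> ?u \<in> F" using c phi_feasible by auto
  have "\<phi> ?m \<subseteq> \<phi> ?u" using A(1,3)[OF m(1)] by auto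
  then have "\<phi> ?m \<subset> \<phi> ?u" using ne c phi_eq_iff by auto
  then obtain e where e: "e \<in> \<phi> ?u - \<phi> ?m" "insert e (\<phi> ?m) \<in> F"
    using accessible m by metis
  have "e \<in> \<phi> y \<or> e \<in> \<phi> z" "e \<in> \<phi> x" using e A(3)[OF m(2)] by auto
  then have "insert e (\<phi> ?m) \<subseteq> \<phi> ?m"
    using A(1,2)[OF e(2)] A(1,2)[OF m(1)] by auto
  then show False using e by blast
qed

lemma join_distributive_L: "join_distributive L"
  by (simp add: join_distributive_def lattice_L finite_carrier semimodular_L meet_semidistributive_L)

lemma chain_in_iff:
  "chain_in L C \<longleftrightarrow> C \<subseteq> carrier L \<and> (\<forall>x\<in>C. \<forall>y\<in>C. \<phi> x \<subseteq> \<phi> y \<or> \<phi> y \<subseteq> \<phi> x)"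
proof -
  have "((x \<sqsubset> y) \<or> x = y \<or> y \<sqsubset> x) = (\<phi> x \<subseteq> \<phi> y \<or> \<phi> y \<subseteq> \<phi> x)"
    if "x \<in> carrier L" "y \<in> carrier L" for x y
    using that phi_eq_iff[of x y] by (auto simp: less_iff)
  then show ?thesis unfolding pred_on.chain_def
    by (smt (verit, best) subset_iff sup2E sup2I1 sup2I2)
qed

lemma inj_on_card_phi:
  assumes "chain_in L C" shows "inj_on (\<lambda>x. card (\<phi> x)) C"
proof (rule inj_onI)
  fix x y assume *: "x \<in> C" "y \<in> C" "card (\<phi> x) = card (\<phi> y)"
  then have "x \<in> carrier L" "y \<in> carrier L" "\<phi> x \<subseteq> \<phi> y \<or> \<phi> y \<subseteq> \<phi> x"
    using assms by (auto simp: chain_in_iff)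
  then show "x = y" using * finite_phi phi_eq_iff card_subset_eq by metis
qed

lemma card_chain_le:
  assumes "chain_in L C" shows "card C \<le> card E + 1"
proof -
  have "(\<lambda>x. card (\<phi> x)) ` C \<subseteq> {0..card E}"
  proof (intro subsetI; elim imageE)
    fix r x assume "r = card (\<phi> x)" "x \<in> C"
    then show "r \<in> {0..card E}"
      using assms card_mono[OF finite_ground] feasible_subset[OF phi_feasible]
      by (auto simp: chain_in_iff)
  qed
  then have "card C \<le> card {0..card E}"
    using inj_on_card_phi[OF assms] by (metis card_inj_on_le finite_atLeastAtMost)
  then show ?thesis by simp
qed

lemma maximal_chainI:
  assumes "chain_in L C" "card C = card E + 1" shows "maximal_chain L C"
  unfolding pred_on.maxchain_def
proof (intro conjI assms notI)
  assume "\<exists>S. chain_in L S \<and> C \<subset> S"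
  then obtain S where S: "chain_in L S" "C \<subset> S" by blast
  then have "finite S" using finite_carrier finite_subset by (auto simp: chain_in_iff)
  then show False using S card_chain_le[OF S(1)] assms psubset_card_mono[of S C] by simp
qed

lemma lattice_length_L:
  assumes "chain_in L C" "card C = card E + 1"
  shows "lattice_length L = enat (card E)"
proof -
  have "C \<noteq> {}" "finite C" using assms by (auto intro: card_ge_0_finite)
  show ?thesis unfolding lattice_length_def
  proof (rule antisym)
    show "(SUP C \<in> {C. chain_in L C \<and> finite C \<and> C \<noteq> {}}. enat (card C - 1)) \<le> enat (card E)"
      using card_chain_le by (auto intro!: SUP_least simp: le_diff_conv)
    show "enat (card E) \<le> (SUP C \<in> {C. chain_in L C \<and> finite C \<and> C \<noteq> {}}. enat (card C - 1))"
      using assms \<open>C \<noteq> {}\<close> \<open>finite C\<close> by (auto intro!: SUP_upper2[of C])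
  qed
qed

text \<open>On a covering pair this is a singleton.\<close>
definition edge_label :: "'a \<times> 'a \<Rightarrow> 'e set" where
  "edge_label p = \<phi> (snd p) - \<phi> (fst p)"

lemma consecutive_same_label:
  assumes "(p, q) \<in> consecutive L" shows "edge_label p = edge_label q"
proof -
  obtain a b where sq: "covering_square L a b"
    and pq: "{p, q} = {(a \<sqinter> b, a), (b, a \<squnion> b)}"
    using assms by (auto simp: consecutive_def)
  have c: "a \<in> carrier L" "b \<in> carrier L" "covers L (a \<sqinter> b) a" "covers L (a \<sqinter> b) b"
    "covers L b (a \<squnion> b)"
    using sq by (auto simp: covering_square_def)
  obtain e f g where e: "e \<notin> \<phi> (a \<sqinter> b)" "\<phi> a = insert e (\<phi> (a \<sqinter> b))"
    and f: "f \<notin> \<phi> (a \<sqinter> b)" "\<phi> b = insert f (\<phi> (a \<sqinter> b))"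
    and g: "g \<notin> \<phi> b" "\<phi> (a \<squnion> b) = insert g (\<phi> b)"
    using c by (auto simp: covers_iff)
  have "e = g" using e f g phi_join[OF c(1,2)] by auto
  then have "edge_label (a \<sqinter> b, a) = edge_label (b, a \<squnion> b)"
    using e g by (auto simp: edge_label_def)
  then show ?thesis using pq by (metis doubleton_eq_iff)
qed

lemma consecutive_closure_same_label:
  assumes "(p, q) \<in> (consecutive L)\<^sup>*" shows "edge_label p = edge_label q"
  using assms by induction (auto dest: consecutive_same_label)

text \<open>Accessibility leads from \<open>x\<close> to \<open>z\<close> by adding one element at a time. Each addition \<open>w\<close> of \<open>x\<close> spans
  a covering square with \<open>y\<close>, because the label of the edge \<open>(x, y)\<close> is different from the added
  element.\<close>
lemma edge_transported_upwards:
  assumes "covers L x y" "z \<in> carrier L" "x \<sqsubseteq> z" "\<not> y \<sqsubseteq> z"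
  shows "((x, y), (z, z \<squnion> y)) \<in> (consecutive L)\<^sup>*"
  using assms
proof (induction "card (\<phi> z - \<phi> x)" arbitrary: x y rule: less_induct)
  case less
  have c: "x \<in> carrier L" "y \<in> carrier L" "z \<in> carrier L" using less.prems by (auto simp: covers_def)
  obtain e where e: "e \<notin> \<phi> x" "\<phi> y = insert e (\<phi> x)" using less.prems by (auto simp: covers_iff)
  have ez: "e \<notin> \<phi> z" "\<phi> x \<subseteq> \<phi> z" using e less.prems c by (auto simp: le_iff)
  show ?case
  proof (cases "x = z")
    case True
    then have "\<phi> (z \<squnion> y) = \<phi> y" using e c phi_join by auto
    then have "z \<squnion> y = y" using c phi_eq_iff by simp
    then show ?thesis using True by simp
  next
    case False
    then have "\<phi> x \<subset> \<phi> z" using ez c phi_eq_iff by auto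
    then obtain f where f: "f \<in> \<phi> z - \<phi> x" "insert f (\<phi> x) \<in> F"
      using accessible phi_feasible c by metis
    then obtain w where w: "w \<in> carrier L" "\<phi> w = insert f (\<phi> x)" using feasible_phi by metis
    have "\<phi> (y \<sqinter> w) \<subseteq> \<phi> x"
      using phi_meet_iff[of y w "\<phi> (y \<sqinter> w)"] c w e f ez phi_feasible by auto
    moreover have "\<phi> x \<subseteq> \<phi> (y \<sqinter> w)"
      using phi_meet_iff[of y w "\<phi> x"] c w e phi_feasible by auto
    ultimately have m: "y \<sqinter> w = x" using c w phi_eq_iff by (metis meet_closed subset_antisym)
    have sq: "covering_square L y w" unfolding covering_square_def m
      using c w e f ez by (auto simp: covers_iff phi_join)
    then have step: "((x, y), (w, y \<squnion> w)) \<in> consecutive L"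
      unfolding consecutive_def using m by blast
    have "((w, y \<squnion> w), (z, z \<squnion> (y \<squnion> w))) \<in> (consecutive L)\<^sup>*"
    proof (rule less.hyps)
      show "card (\<phi> z - \<phi> w) < card (\<phi> z - \<phi> x)"
        using f w finite_phi c by (intro psubset_card_mono) auto
    qed (use sq c w f ez e in \<open>auto simp: covering_square_def le_iff phi_join\<close>)
    moreover have "z \<squnion> (y \<squnion> w) = z \<squnion> y"
    proof -
      have "\<phi> (z \<squnion> (y \<squnion> w)) = \<phi> (z \<squnion> y)" using c w f ez by (auto simp: phi_join)
      then show ?thesis using c w phi_eq_iff by simp
    qed
    ultimately show ?thesis using step by simp
  qed
qed

text \<open>Both edges are transported up to \<open>x \<squnion> x'\<close>, which does not contain their common label; there they coincide.\<close>
lemma same_label_consecutive_closure: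
  assumes "covers L x y" "covers L x' y'" "edge_label (x, y) = edge_label (x', y')"
  shows "((x, y), (x', y')) \<in> (consecutive L)\<^sup>*"
proof -
  have c: "x \<in> carrier L" "y \<in> carrier L" "x' \<in> carrier L" "y' \<in> carrier L"
    using assms by (auto simp: covers_def)
  obtain e where e: "e \<notin> \<phi> x" "\<phi> y = insert e (\<phi> x)" using assms(1) by (auto simp: covers_iff)
  obtain e' where e': "e' \<notin> \<phi> x'" "\<phi> y' = insert e' (\<phi> x')" using assms(2) by (auto simp: covers_iff)
  have "e' = e" using e e' assms(3) by (auto simp: edge_label_def)
  define z where "z = x \<squnion> x'"
  have z: "z \<in> carrier L" "\<phi> z = \<phi> x \<union> \<phi> x'" using c by (auto simp: z_def phi_join)
  have "((x, y), (z, z \<squnion> y)) \<in> (consecutive L)\<^sup>*"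
    using assms(1) c z e e' \<open>e' = e\<close> by (intro edge_transported_upwards) (auto simp: le_iff)
  moreover have "((x', y'), (z, z \<squnion> y')) \<in> (consecutive L)\<^sup>*"
    using assms(2) c z e e' \<open>e' = e\<close> by (intro edge_transported_upwards) (auto simp: le_iff)
  moreover have "z \<squnion> y = z \<squnion> y'"
  proof -
    have "\<phi> (z \<squnion> y) = \<phi> (z \<squnion> y')" using c z e e' \<open>e' = e\<close> by (auto simp: phi_join)
    then show ?thesis using c z phi_eq_iff by simp
  qed
  moreover have "sym ((consecutive L)\<^sup>*)"
    by (rule sym_rtrancl) (auto simp: sym_def consecutive_def insert_commute)
  ultimately show ?thesis by (metis symD rtrancl_trans)
qed

text \<open>Trajectories are the classes of edges with a common label.\<close>
lemma same_trajectory_iff: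
  assumes "covers L x y" "covers L x' y'"
  shows "(\<exists>T\<in>trajectories L. (x, y) \<in> T \<and> (x', y') \<in> T) \<longleftrightarrow>
    edge_label (x, y) = edge_label (x', y')"
proof
  assume "\<exists>T\<in>trajectories L. (x, y) \<in> T \<and> (x', y') \<in> T"
  then obtain r where "(r, (x, y)) \<in> (consecutive L)\<^sup>*" "(r, (x', y')) \<in> (consecutive L)\<^sup>*"
    by (auto simp: trajectories_def quotient_def)
  then show "edge_label (x, y) = edge_label (x', y')"
    using consecutive_closure_same_label by metis
next
  assume "edge_label (x, y) = edge_label (x', y')"
  then have "((x, y), (x', y')) \<in> (consecutive L)\<^sup>*"
    using assms same_label_consecutive_closure by blast
  then show "\<exists>T\<in>trajectories L. (x, y) \<in> T \<and> (x', y') \<in> T"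
    using assms by (auto simp: trajectories_def prime_intervals_def intro!: bexI[OF _ quotientI])
qed

end

section \<open>Initial segments of linear orders\<close>

definition perm_prefix :: "nat \<Rightarrow> (nat \<Rightarrow> nat) \<Rightarrow> nat \<Rightarrow> nat set" where
  "perm_prefix n p m = {e \<in> {1..n}. p e \<le> m}"

lemma perm_prefix_mono: "m \<le> m' \<Longrightarrow> perm_prefix n p m \<subseteq> perm_prefix n p m'"
  by (auto simp: perm_prefix_def)

lemma perm_prefix_0:
  assumes "p permutes {1..n}" shows "perm_prefix n p 0 = {}"
proof -
  have "p e \<noteq> 0" if "e \<in> {1..n}" for e
    using permutes_in_image[OF assms, of e] that by auto
  then show ?thesis by (auto simp: perm_prefix_def)
qed

lemma inv_permutes_in:
  assumes "p permutes {1..n}" "i \<in> {1..n}" shows "inv p i \<in> {1..n}" "p (inv p i) = i"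
  using assms(2) permutes_in_image[OF permutes_inv[OF assms(1)]] permutes_inverses(1)[OF assms(1)]
  by simp_all

lemma perm_prefix_Suc:
  assumes "p permutes {1..n}" "i \<in> {1..n}"
  shows "perm_prefix n p i = insert (inv p i) (perm_prefix n p (i - 1))"
    and "inv p i \<notin> perm_prefix n p (i - 1)"
proof -
  have "p e \<le> i \<longleftrightarrow> e = inv p i \<or> p e \<le> i - 1" for e
    using assms permutes_inv_eq[OF assms(1)] inv_permutes_in[OF assms] by (metis One_nat_def
        Suc_pred atLeastAtMost_iff le_Suc_eq less_eq_Suc_le order_refl)
  then show "perm_prefix n p i = insert (inv p i) (perm_prefix n p (i - 1))"
    using inv_permutes_in[OF assms] by (auto simp: perm_prefix_def)
  show "inv p i \<notin> perm_prefix n p (i - 1)"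
    using inv_permutes_in[OF assms] assms by (auto simp: perm_prefix_def)
qed

lemma card_perm_prefix:
  assumes "p permutes {1..n}" "m \<le> n" shows "card (perm_prefix n p m) = m"
  using assms(2)
proof (induction m)
  case (Suc m)
  have "finite (perm_prefix n p m)" by (simp add: perm_prefix_def)
  then show ?case using Suc perm_prefix_Suc[OF assms(1), of "Suc m"] by simp
qed (simp add: perm_prefix_0[OF assms(1)])

lemma perm_prefix_subset_iff:
  assumes "p permutes {1..n}" "m \<le> n" "m' \<le> n"
  shows "perm_prefix n p m \<subseteq> perm_prefix n p m' \<longleftrightarrow> m \<le> m'"
  using assms card_perm_prefix card_mono[of "perm_prefix n p m'" "perm_prefix n p m"]
    perm_prefix_mono by (metis finite_atLeastAtMost finite_Collect_conjI perm_prefix_def Collect_mem_eq)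

lemma perm_prefix_eq_iff:
  assumes "p permutes {1..n}" "m \<le> n" "m' \<le> n"
  shows "perm_prefix n p m = perm_prefix n p m' \<longleftrightarrow> m = m'"
  using assms card_perm_prefix by metis

text \<open>From now on the ground set is \<open>{1..n}\<close>, and linear orders on it are given by permutations \<open>p\<close> that
  send an element to its place. The element at place \<open>i\<close> is then \<open>inv p i\<close>.\<close>
locale interval_antimatroid_order = antimatroid_order "{1..n}" F L \<phi>
  for n :: nat and F :: "nat set set" and L :: "'a gorder" (structure) and \<phi> :: "'a \<Rightarrow> nat set"
begin

context
  fixes p C
  assumes p: "p permutes {1..n}" and C: "C \<subseteq> carrier L"
    and phi_C: "\<phi> ` C = perm_prefix n p ` {0..n}"
begin

lemma bij_prefix_chain: "bij_betw \<phi> C (perm_prefix n p ` {0..n})"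
  using C phi_C phi_eq_iff by (metis bij_betw_def inj_onI subsetD)

lemma prefix_chain_card: "card C = n + 1"
proof -
  have "inj_on (perm_prefix n p) {0..n}" using perm_prefix_eq_iff[OF p] by (auto intro: inj_onI)
  then show ?thesis using bij_betw_same_card[OF bij_prefix_chain] by (simp add: card_image)
qed

lemma prefix_chain_chain: "chain_in L C"
proof -
  have "\<exists>m\<in>{0..n}. \<phi> x = perm_prefix n p m" if "x \<in> C" for x using phi_C that by blast
  then show ?thesis using C perm_prefix_mono unfolding chain_in_iff by (metis nle_le)
qed

lemma prefix_chain_maximal: "maximal_chain L C"
  using maximal_chainI prefix_chain_chain prefix_chain_card by simp

lemma prefix_chain_length: "lattice_length L = enat n"
  using lattice_length_L prefix_chain_chain prefix_chain_card by simp

text \<open>The initial segments properly contained in the one of length \<open>m\<close> are those of length less than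
  \<open>m\<close>, so the rank in the chain is the length of the segment.\<close>
lemma prefix_chain_elem:
  assumes "i \<le> n"
  shows "chain_elem L C i \<in> C" "\<phi> (chain_elem L C i) = perm_prefix n p i"
proof -
  have rank: "card {x \<in> C. x \<sqsubset> c} = m" if "c \<in> C" "\<phi> c = perm_prefix n p m" "m \<le> n" for c m
  proof -
    have "x \<sqsubset> c \<longleftrightarrow> \<phi> x \<subset> \<phi> c" if "x \<in> C" for x
      using that \<open>c \<in> C\<close> C by (intro less_iff) blast+
    then have "\<phi> ` {x \<in> C. x \<sqsubset> c} = {A \<in> \<phi> ` C. A \<subset> \<phi> c}" by blast
    also have "\<dots> = perm_prefix n p ` {i \<in> {0..n}. perm_prefix n p i \<subset> perm_prefix n p m}"
      unfolding phi_C \<open>\<phi> c = perm_prefix n p m\<close> by blast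
    also have "{i \<in> {0..n}. perm_prefix n p i \<subset> perm_prefix n p m} = {0..<m}"
    proof (rule Set.set_eqI)
      fix i show "i \<in> {i \<in> {0..n}. perm_prefix n p i \<subset> perm_prefix n p m} \<longleftrightarrow> i \<in> {0..<m}"
        using perm_prefix_subset_iff[OF p _ \<open>m \<le> n\<close>, of i] \<open>m \<le> n\<close>
          perm_prefix_eq_iff[OF p _ \<open>m \<le> n\<close>, of i] by (cases "i \<le> n") (auto simp: psubset_eq)
    qed
    finally have image: "\<phi> ` {x \<in> C. x \<sqsubset> c} = perm_prefix n p ` {0..<m}" .
    have "card {x \<in> C. x \<sqsubset> c} = card (\<phi> ` {x \<in> C. x \<sqsubset> c})"
      using bij_prefix_chain by (intro card_image[symmetric]) (auto simp: bij_betw_def inj_on_def)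
    also have "\<dots> = card {0..<m}" unfolding image
      using perm_prefix_eq_iff[OF p] that by (intro card_image) (auto intro!: inj_onI)
    finally show ?thesis by simp
  qed
  obtain c where c: "c \<in> C" "\<phi> c = perm_prefix n p i"
  proof -
    have "perm_prefix n p i \<in> \<phi> ` C" using phi_C assms by simp
    then show ?thesis using that by (elim imageE) simp
  qed
  have "chain_elem L C i = c" unfolding chain_elem_def
  proof (rule the_equality)
    fix d assume d: "d \<in> C \<and> card {x \<in> C. x \<sqsubset> d} = i"
    then obtain m where m: "m \<le> n" "\<phi> d = perm_prefix n p m"
    proof -
      have "\<phi> d \<in> perm_prefix n p ` {0..n}" using phi_C d by blast
      then show ?thesis using that by (elim imageE) simp
    qed
    then have "m = i" using rank d by blast
    then show "d = c" using c d m C phi_eq_iff by (metis subsetD)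
  qed (use rank c assms in blast)
  then show "chain_elem L C i \<in> C" "\<phi> (chain_elem L C i) = perm_prefix n p i" using c by auto
qed

lemma prefix_chain_edge:
  assumes "i \<in> {1..n}"
  shows "covers L (chain_elem L C (i - 1)) (chain_elem L C i)"
    and "edge_label (chain_elem L C (i - 1), chain_elem L C i) = {inv p i}"
proof -
  have "chain_elem L C i \<in> carrier L" "\<phi> (chain_elem L C i) = perm_prefix n p i"
    "chain_elem L C (i - 1) \<in> carrier L" "\<phi> (chain_elem L C (i - 1)) = perm_prefix n p (i - 1)"
    using prefix_chain_elem[of i] prefix_chain_elem[of "i - 1"] assms C by auto
  then show "covers L (chain_elem L C (i - 1)) (chain_elem L C i)"
    "edge_label (chain_elem L C (i - 1), chain_elem L C i) = {inv p i}"
    using perm_prefix_Suc[OF p assms] by (auto simp: covers_iff edge_label_def)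
qed

end

text \<open>The \<open>i\<close>-th edge of \<open>C\<close> and the \<open>j\<close>-th edge of \<open>D\<close> lie in the same trajectory iff \<open>inv p i = inv q j\<close>.\<close>
lemma JH_perm_prefix_chains:
  assumes p: "p permutes {1..n}" "C \<subseteq> carrier L" "\<phi> ` C = perm_prefix n p ` {0..n}"
    and q: "q permutes {1..n}" "D \<subseteq> carrier L" "\<phi> ` D = perm_prefix n q ` {0..n}"
  shows "JH_perm n L C D = q \<circ> inv p"
proof -
  have iff: "(\<exists>T\<in>trajectories L. chain_interval L C i \<in> T \<and> chain_interval L D j \<in> T)
      \<longleftrightarrow> (q \<circ> inv p) i = j" if "i \<in> {1..n}" "j \<in> {1..n}" for i j
  proof -
    have "(\<exists>T\<in>trajectories L. chain_interval L C i \<in> T \<and> chain_interval L D j \<in> T)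
      \<longleftrightarrow> edge_label (chain_interval L C i) = edge_label (chain_interval L D j)"
      unfolding chain_interval_def
      by (rule same_trajectory_iff[OF prefix_chain_edge(1)[OF p that(1)] prefix_chain_edge(1)[OF q that(2)]])
    also have "\<dots> \<longleftrightarrow> inv q j = inv p i"
      unfolding chain_interval_def prefix_chain_edge(2)[OF p that(1)] prefix_chain_edge(2)[OF q that(2)]
      by auto
    also have "\<dots> \<longleftrightarrow> (q \<circ> inv p) i = j" unfolding comp_apply by (rule permutes_inv_eq[OF q(1)])
    finally show ?thesis .
  qed
  have perm: "(q \<circ> inv p) permutes {1..n}"
    by (intro permutes_compose permutes_inv p q)
  show ?thesis unfolding JH_perm_def
  proof (rule the_equality)
    fix r assume r: "r permutes {1..n} \<and> (\<forall>i\<in>{1..n}. \<forall>j\<in>{1..n}. r i = j \<longleftrightarrow>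
        (\<exists>T\<in>trajectories L. chain_interval L C i \<in> T \<and> chain_interval L D j \<in> T))"
    show "r = q \<circ> inv p"
    proof
      fix i show "r i = (q \<circ> inv p) i"
      proof (cases "i \<in> {1..n}")
        case True
        have ri: "r i \<in> {1..n}" by (rule permutes_in_image[OF conjunct1[OF r], THEN iffD2, OF True])
        show ?thesis
          by (rule iffD1[OF iff[OF True ri]
                iffD1[OF bspec[OF bspec[OF conjunct2[OF r] True] ri] HOL.refl], symmetric])
      next
        case False
        then show ?thesis using permutes_not_in[OF conjunct1[OF r]] permutes_not_in[OF perm]
          by simp
      qed
    qed
  qed (use perm iff in blast)
qed

end

text \<open>The unions of initial segments of the \<open>k\<close> orders, characterised without naming the segments: every
  element \<open>e\<close> of such a set lies in an initial segment inside the set, which can be cut off at \<open>e\<close>.\<close>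
definition prefix_unions :: "nat \<Rightarrow> nat \<Rightarrow> (nat \<Rightarrow> nat \<Rightarrow> nat) \<Rightarrow> nat set set" where
  "prefix_unions n k \<pi> = {A. A \<subseteq> {1..n} \<and>
     (\<forall>e\<in>A. \<exists>j\<in>{1..k}. perm_prefix n (perm1 \<pi> j) (perm1 \<pi> j e) \<subseteq> A)}"

lemma perm1_permutes:
  assumes "\<pi> \<in> perm_tuples n k" "j \<in> {1..k}" shows "perm1 \<pi> j permutes {1..n}"
proof (cases "j = 1")
  case True then show ?thesis by (simp add: perm1_def permutes_id)
next
  case False then show ?thesis using assms by (auto simp: perm1_def perm_tuples_def)
qed

lemma perm_prefix_in_prefix_unions:
  assumes "j \<in> {1..k}" shows "perm_prefix n (perm1 \<pi> j) m \<in> prefix_unions n k \<pi>"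
  using assms by (auto simp: prefix_unions_def perm_prefix_def intro!: bexI[of _ j])

text \<open>For accessibility, take an element \<open>e\<close> of \<open>B - A\<close>, an order whose segment up to \<open>e\<close> is inside
  \<open>B\<close>, and the first element of this segment that is not in \<open>A\<close>: everything before it is in \<open>A\<close>.\<close>
lemma antimatroid_prefix_unions:
  assumes "\<pi> \<in> perm_tuples n k"
  shows "antimatroid {1..n} (prefix_unions n k \<pi>)"
proof
  fix A B assume AB: "A \<in> prefix_unions n k \<pi>" "B \<in> prefix_unions n k \<pi>"
  show "A \<union> B \<in> prefix_unions n k \<pi>"
    using AB unfolding prefix_unions_def by blast
  assume "A \<subset> B"
  then obtain e where e: "e \<in> B" "e \<notin> A" by auto
  then obtain j where j: "j \<in> {1..k}" "perm_prefix n (perm1 \<pi> j) (perm1 \<pi> j e) \<subseteq> B"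
    using AB by (auto simp: prefix_unions_def)
  let ?p = "perm1 \<pi> j"
  have p: "?p permutes {1..n}" using perm1_permutes assms j by blast
  have eP: "e \<in> perm_prefix n ?p (?p e)" using e AB by (auto simp: perm_prefix_def prefix_unions_def)
  obtain f where f: "f \<in> perm_prefix n ?p (?p e) - A"
    and min: "\<And>g. g \<in> perm_prefix n ?p (?p e) - A \<Longrightarrow> ?p f \<le> ?p g"
    using eP e exists_least_iff[of "\<lambda>m. \<exists>f \<in> perm_prefix n ?p (?p e) - A. ?p f = m"]
    by (metis DiffI not_le)
  have "perm_prefix n ?p (?p f) \<subseteq> insert f A"
  proof
    fix g assume g: "g \<in> perm_prefix n ?p (?p f)"
    then have "g \<in> perm_prefix n ?p (?p e)" using f by (auto simp: perm_prefix_def)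
    then have "g \<in> A \<or> ?p f \<le> ?p g" using min[of g] by blast
    then have "g \<in> A \<or> ?p g = ?p f" using g by (auto simp: perm_prefix_def)
    then show "g \<in> insert f A" using permutes_inj[OF p] by (auto dest: injD)
  qed
  moreover have "f \<in> {1..n}" using f by (auto simp: perm_prefix_def)
  ultimately have "insert f A \<in> prefix_unions n k \<pi>"
    using AB(1) j(1) unfolding prefix_unions_def by blast
  then show "\<exists>f\<in>B - A. insert f A \<in> prefix_unions n k \<pi>" using f j by blast
qed (auto simp: prefix_unions_def)

text \<open>Only the order of \<open>L\<close> enters, not its being a lattice: that follows, and so the notion can be
  checked for systems that are merely ordered.\<close>
definition prefix_representation ::
    "nat \<Rightarrow> nat \<Rightarrow> (nat \<Rightarrow> nat \<Rightarrow> nat) \<Rightarrow> 'a chain_system \<Rightarrow> ('a \<Rightarrow> nat set) \<Rightarrow> bool" where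
  "prefix_representation n k \<pi> = (\<lambda>(L, C) \<phi>.
     eq L = (=) \<and> bij_betw \<phi> (carrier L) (prefix_unions n k \<pi>) \<and>
     (\<forall>x\<in>carrier L. \<forall>y\<in>carrier L. x \<sqsubseteq>\<^bsub>L\<^esub> y \<longleftrightarrow> \<phi> x \<subseteq> \<phi> y) \<and>
     (\<forall>j\<in>{1..k}. C j \<subseteq> carrier L \<and> \<phi> ` C j = perm_prefix n (perm1 \<pi> j) ` {0..n}))"

lemma antimatroid_order_representation:
  assumes "prefix_representation n k \<pi> (L, C) \<phi>" "\<pi> \<in> perm_tuples n k"
  shows "interval_antimatroid_order n (prefix_unions n k \<pi>) L \<phi>"
proof -
  interpret antimatroid "{1..n}" "prefix_unions n k \<pi>"
    by (rule antimatroid_prefix_unions[OF assms(2)])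
  show ?thesis
  proof unfold_locales
    show "eq L = (=)" "bij_betw \<phi> (carrier L) (prefix_unions n k \<pi>)"
      using assms(1) by (simp_all add: prefix_representation_def)
    show "x \<sqsubseteq>\<^bsub>L\<^esub> y \<longleftrightarrow> \<phi> x \<subseteq> \<phi> y" if "x \<in> carrier L" "y \<in> carrier L" for x y
      using assms(1) that by (simp add: prefix_representation_def)
  qed
qed

text \<open>The lattice part holds in every antimatroid. For the join-irreducible elements: if \<open>x\<close> has the only
  lower cover \<open>y\<close>, and \<open>e\<close> is the label of this edge, then an initial segment inside \<open>x\<close> that contains
  \<open>e\<close> is not below \<open>y\<close>. By coaccessibility it would be below some lower cover if it were
  proper, so it is all of \<open>x\<close>.\<close>
lemma representation_JD_system:
  assumes r: "prefix_representation n k \<pi> (L, C) \<phi>" and pi: "\<pi> \<in> perm_tuples n k" and k: "k \<ge> 1"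
  shows "JD_system n k (L, C)"
proof -
  interpret interval_antimatroid_order n "prefix_unions n k \<pi>" L \<phi>
    using antimatroid_order_representation[OF r pi] .
  have C: "perm1 \<pi> j permutes {1..n}" "C j \<subseteq> carrier L"
    "\<phi> ` C j = perm_prefix n (perm1 \<pi> j) ` {0..n}" if "j \<in> {1..k}" for j
    using that r perm1_permutes[OF pi that] by (auto simp: prefix_representation_def)
  have "Ji L \<subseteq> (\<Union>i\<in>{1..k}. C i)"
  proof
    fix x assume "x \<in> Ji L"
    then obtain y where x: "x \<in> carrier L" and y: "covers L y x"
      and unique: "\<And>z. covers L z x \<Longrightarrow> z = y"
      by (auto simp: Ji_def)
    obtain e where e: "e \<notin> \<phi> y" "\<phi> x = insert e (\<phi> y)" "y \<in> carrier L" using y by (auto simp: covers_iff)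
    then obtain j where j: "j \<in> {1..k}" "perm_prefix n (perm1 \<pi> j) (perm1 \<pi> j e) \<subseteq> \<phi> x"
      using phi_feasible[OF x] by (auto simp: prefix_unions_def)
    let ?P = "perm_prefix n (perm1 \<pi> j) (perm1 \<pi> j e)"
    have e_n: "e \<in> {1..n}" using phi_feasible[OF x] e by (auto simp: prefix_unions_def)
    have "?P = \<phi> x"
    proof (rule ccontr)
      assume "?P \<noteq> \<phi> x"
      then obtain f where f: "f \<in> \<phi> x - ?P" "\<phi> x - {f} \<in> prefix_unions n k \<pi>"
        using coaccessible[of ?P "\<phi> x"] j perm_prefix_in_prefix_unions phi_feasible x by blast
      obtain z where z: "z \<in> carrier L" "\<phi> z = \<phi> x - {f}" using f feasible_phi by metis
      then have "covers L z x" using f x by (auto simp: covers_iff)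
      then have "z = y" by (rule unique)
      moreover have "e \<in> ?P" using e_n by (auto simp: perm_prefix_def)
      ultimately show False using e f z by auto
    qed
    moreover have "perm1 \<pi> j e \<le> n" using permutes_in_image[OF C(1)[OF j(1)]] e_n by auto
    ultimately have "\<phi> x \<in> \<phi> ` C j" using C(3)[OF j(1)] by auto
    then have "x \<in> C j" using C(2)[OF j(1)] x phi_eq_iff by (metis imageE subsetD)
    then show "x \<in> (\<Union>i\<in>{1..k}. C i)" using j by blast
  qed
  moreover have "lattice_length L = enat n" using prefix_chain_length[OF C[of 1]] k by simp
  moreover have "\<forall>i\<in>{1..k}. maximal_chain L (C i)" using prefix_chain_maximal[OF C] by blast
  ultimately show ?thesis
    using join_distributive_L by (simp only: JD_system_def case_prod_conv)
qed

lemma representation_system_perms: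
  assumes r: "prefix_representation n k \<pi> (L, C) \<phi>" and pi: "\<pi> \<in> perm_tuples n k" and k: "k \<ge> 1"
  shows "system_perms n k (L, C) = \<pi>"
proof -
  interpret interval_antimatroid_order n "prefix_unions n k \<pi>" L \<phi>
    using antimatroid_order_representation[OF r pi] .
  have C: "perm1 \<pi> j permutes {1..n}" "C j \<subseteq> carrier L"
    "\<phi> ` C j = perm_prefix n (perm1 \<pi> j) ` {0..n}" if "j \<in> {1..k}" for j
    using that r perm1_permutes[OF pi that] by (auto simp: prefix_representation_def)
  show ?thesis
  proof (rule extensionalityI[of _ "{2..k}"])
    show "system_perms n k (L, C) \<in> extensional {2..k}" by (simp add: system_perms_def)
    show "\<pi> \<in> extensional {2..k}" using pi by (auto simp: perm_tuples_def PiE_def)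
    fix j assume j: "j \<in> {2..k}"
    then have "JH_perm n L (C 1) (C j) = perm1 \<pi> j \<circ> inv (perm1 \<pi> 1)"
      using C[of 1] C[of j] k by (intro JH_perm_prefix_chains) auto
    then show "system_perms n k (L, C) j = \<pi> j"
      using j by (simp add: system_perms_def perm1_def inv_id)
  qed
qed

lemma representation_isomorphic:
  assumes r: "prefix_representation n k \<pi> (L, C) \<phi>" and s: "prefix_representation n k \<pi> (M, D) \<psi>"
    and pi: "\<pi> \<in> perm_tuples n k"
  shows "isomorphic_systems k (L, C) (M, D)"
proof -
  interpret L: interval_antimatroid_order n "prefix_unions n k \<pi>" L \<phi>
    using antimatroid_order_representation[OF r pi] .
  interpret M: interval_antimatroid_order n "prefix_unions n k \<pi>" M \<psi>
    using antimatroid_order_representation[OF s pi] .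
  define f where "f = inv_into (carrier M) \<psi> \<circ> \<phi>"
  have bij: "bij_betw f (carrier L) (carrier M)" unfolding f_def
    using L.bij_phi M.bij_phi by (blast intro: bij_betw_trans bij_betw_inv_into)
  have f: "f x \<in> carrier M" "\<psi> (f x) = \<phi> x" if "x \<in> carrier L" for x
    using that bij_betwE[OF bij] bij_betw_inv_into_right[OF M.bij_phi L.phi_feasible[OF that]]
    by (simp_all add: f_def)
  have "lattice_iso L M f" unfolding lattice_iso_def
  proof (intro conjI ballI L.lattice_L M.lattice_L bij)
    fix x y assume xy: "x \<in> carrier L" "y \<in> carrier L"
    have "\<psi> (f (x \<squnion>\<^bsub>L\<^esub> y)) = \<psi> (f x \<squnion>\<^bsub>M\<^esub> f y)" using xy f by (simp add: L.phi_join M.phi_join)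
    then show "f (x \<squnion>\<^bsub>L\<^esub> y) = f x \<squnion>\<^bsub>M\<^esub> f y" by (subst (asm) M.phi_eq_iff) (simp_all add: xy f)
    have "\<psi> (f (x \<sqinter>\<^bsub>L\<^esub> y)) = \<psi> (f x \<sqinter>\<^bsub>M\<^esub> f y)" using xy f by (simp add: L.phi_meet M.phi_meet)
    then show "f (x \<sqinter>\<^bsub>L\<^esub> y) = f x \<sqinter>\<^bsub>M\<^esub> f y" by (subst (asm) M.phi_eq_iff) (simp_all add: xy f)
  qed
  moreover have "f ` C i = D i" if i: "i \<in> {1..k}" for i
  proof -
    have C: "C i \<subseteq> carrier L" "D i \<subseteq> carrier M" "\<phi> ` C i = \<psi> ` D i"
      using r s i by (auto simp: prefix_representation_def)
    have "\<psi> ` f ` C i = \<phi> ` C i" 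
      unfolding image_image by (rule image_cong) (use f C(1) in auto)
    moreover have "f ` C i \<subseteq> carrier M" using f(1) C(1) by auto
    ultimately show ?thesis
      using C inj_on_image_eq_iff[of \<psi> "carrier M" "f ` C i" "D i"] M.bij_phi
      by (simp add: bij_betw_def)
  qed
  ultimately show ?thesis unfolding isomorphic_systems_def case_prod_conv by (intro exI[of _ f]) auto
qed

lemma lattice_iso_le_iff:
  assumes "lattice_iso L M f" "x \<in> carrier L" "y \<in> carrier L"
  shows "f x \<sqsubseteq>\<^bsub>M\<^esub> f y \<longleftrightarrow> x \<sqsubseteq>\<^bsub>L\<^esub> y"
proof -
  interpret L: lattice L using assms by (simp add: lattice_iso_def)
  interpret M: lattice M using assms by (simp add: lattice_iso_def)
  have bij: "bij_betw f (carrier L) (carrier M)" using assms by (simp add: lattice_iso_def)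
  have "f x \<sqsubseteq>\<^bsub>M\<^esub> f y \<longleftrightarrow> f x = f x \<sqinter>\<^bsub>M\<^esub> f y"
    using bij assms bij_betwE by (intro M.le_iff_join) blast+
  also have "\<dots> \<longleftrightarrow> f x = f (x \<sqinter>\<^bsub>L\<^esub> y)" using assms by (simp add: lattice_iso_def)
  also have "\<dots> \<longleftrightarrow> x = x \<sqinter>\<^bsub>L\<^esub> y"
    using bij assms by (metis bij_betw_def inj_on_eq_iff L.meet_closed)
  also have "\<dots> \<longleftrightarrow> x \<sqsubseteq>\<^bsub>L\<^esub> y" using assms L.le_iff_join by blast
  finally show ?thesis .
qed

text \<open>Isomorphic systems have the same representations up to composition with the isomorphism. Invariance of
  length, trajectories and Jordan--Hoelder permutations under isomorphism thereby never has to be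
  proved separately.\<close>
lemma isomorphic_representation:
  assumes r: "prefix_representation n k \<pi> (L, C) \<phi>" and iso: "isomorphic_systems k (L, C) (M, D)"
  shows "\<exists>\<psi>. prefix_representation n k \<pi> (M, D) \<psi>"
proof -
  obtain f where f: "lattice_iso L M f" and CD: "\<And>i. i \<in> {1..k} \<Longrightarrow> f ` C i = D i"
    using iso by (auto simp: isomorphic_systems_def)
  define g where "g = inv_into (carrier L) f"
  interpret M: lattice M using f by (simp add: lattice_iso_def)
  have bij: "bij_betw f (carrier L) (carrier M)" using f by (simp add: lattice_iso_def)
  have bij_g: "bij_betw g (carrier M) (carrier L)" unfolding g_def by (rule bij_betw_inv_into[OF bij])
  have g: "g x \<in> carrier L" "f (g x) = x" if "x \<in> carrier M" for x
    using that bij_betwE[OF bij_g] bij_betw_inv_into_right[OF bij that] by (simp_all add: g_def)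
  have gf: "g (f x) = x" if "x \<in> carrier L" for x
    using that bij by (auto simp: g_def bij_betw_inv_into_left)
  have "prefix_representation n k \<pi> (M, D) (\<phi> \<circ> g)"
    unfolding prefix_representation_def case_prod_conv
  proof (intro conjI ballI)
    show "eq M = (=)" by (rule M.eq_is_equal)
    show "bij_betw (\<phi> \<circ> g) (carrier M) (prefix_unions n k \<pi>)"
      using r bij_g by (auto simp: prefix_representation_def intro: bij_betw_trans)
    show "x \<sqsubseteq>\<^bsub>M\<^esub> y \<longleftrightarrow> (\<phi> \<circ> g) x \<subseteq> (\<phi> \<circ> g) y" if "x \<in> carrier M" "y \<in> carrier M" for x y
      using lattice_iso_le_iff[OF f, of "g x" "g y"] g[OF that(1)] g[OF that(2)] r
      by (auto simp: prefix_representation_def)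
    fix j assume j: "j \<in> {1..k}"
    have C: "C j \<subseteq> carrier L" "\<phi> ` C j = perm_prefix n (perm1 \<pi> j) ` {0..n}"
      using r j by (auto simp: prefix_representation_def)
    show "D j \<subseteq> carrier M" using CD[OF j, symmetric] C(1) bij_betwE[OF bij] by auto
    have "g ` D j = (\<lambda>x. x) ` C j"
      unfolding CD[OF j, symmetric] image_image by (rule image_cong) (use gf C(1) in auto)
    then show "(\<phi> \<circ> g) ` D j = perm_prefix n (perm1 \<pi> j) ` {0..n}" 
      unfolding image_comp[symmetric] using C(2) by simp
  qed
  then show ?thesis by (intro exI[where x = "\<phi> \<circ> g"])
qed

lemma iso_class_eq_representable:
  assumes "prefix_representation n k \<pi> S \<phi>" "\<pi> \<in> perm_tuples n k"
  shows "iso_class k S = {T. \<exists>\<psi>. prefix_representation n k \<pi> T \<psi>}"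
proof (intro equalityI subsetI)
  obtain L C where S: "S = (L, C)" by (cases S)
  fix T :: "'b chain_system"
  obtain M D where T: "T = (M, D)" by (cases T)
  show "T \<in> {T. \<exists>\<psi>. prefix_representation n k \<pi> T \<psi>}" if "T \<in> iso_class k S"
    using isomorphic_representation[OF assms(1)[unfolded S]] that
    by (simp add: iso_class_def S T)
  show "T \<in> iso_class k S" if "T \<in> {T. \<exists>\<psi>. prefix_representation n k \<pi> T \<psi>}"
    using representation_isomorphic[OF assms(1)[unfolded S] _ assms(2)] that
    by (auto simp: iso_class_def S T)
qed

section \<open>The lattice of eligible tuples\<close>

text \<open>The upper adjoint of \<open>tuple_union\<close> below: \<open>tuple_union n k \<pi> x \<subseteq> A\<close> iff \<open>x\<close> is componentwise
  at most \<open>longest_prefixes n k \<pi> A\<close>.\<close>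
definition longest_prefixes :: "nat \<Rightarrow> nat \<Rightarrow> (nat \<Rightarrow> nat \<Rightarrow> nat) \<Rightarrow> nat set \<Rightarrow> nat \<Rightarrow> nat" where
  "longest_prefixes n k \<pi> A = (\<lambda>j\<in>{1..k}. Max {m \<in> {0..n}. perm_prefix n (perm1 \<pi> j) m \<subseteq> A})"

definition tuple_union :: "nat \<Rightarrow> nat \<Rightarrow> (nat \<Rightarrow> nat \<Rightarrow> nat) \<Rightarrow> (nat \<Rightarrow> nat) \<Rightarrow> nat set" where
  "tuple_union n k \<pi> x = (\<Union>j\<in>{1..k}. perm_prefix n (perm1 \<pi> j) (x j))"

context
  fixes n k :: nat and \<pi> :: "nat \<Rightarrow> nat \<Rightarrow> nat"
  assumes pi: "\<pi> \<in> perm_tuples n k"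
begin

interpretation antimatroid "{1..n}" "prefix_unions n k \<pi>"
  by (rule antimatroid_prefix_unions[OF pi])

private abbreviation (input) "P j m \<equiv> perm_prefix n (perm1 \<pi> j) m"
private abbreviation (input) "G \<equiv> longest_prefixes n k \<pi>"
private abbreviation (input) "U \<equiv> tuple_union n k \<pi>"

lemma longest_prefixes_le: "j \<in> {1..k} \<Longrightarrow> G A j \<le> n"
  and longest_prefixes_iff: "j \<in> {1..k} \<Longrightarrow> m \<le> n \<Longrightarrow> P j m \<subseteq> A \<longleftrightarrow> m \<le> G A j"
proof -
  assume j: "j \<in> {1..k}"
  let ?M = "{m \<in> {0..n}. P j m \<subseteq> A}"
  have fin: "finite ?M" by simp
  have "0 \<in> ?M" using perm_prefix_0[OF perm1_permutes[OF pi j]] by simp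
  then have max: "Max ?M \<in> ?M" using fin Max_in by blast
  have G: "G A j = Max ?M" using j by (simp add: longest_prefixes_def)
  show "G A j \<le> n" using max G by simp
  show "P j m \<subseteq> A \<longleftrightarrow> m \<le> G A j" if "m \<le> n"
  proof
    assume "P j m \<subseteq> A" then show "m \<le> G A j" using G that Max_ge[OF fin] by simp
  next
    assume "m \<le> G A j"
    then have "P j m \<subseteq> P j (Max ?M)" using G perm_prefix_mono by simp
    also have "\<dots> \<subseteq> A" using max by simp
    finally show "P j m \<subseteq> A" .
  qed
qed

text \<open>Eligibility means that no component can be increased without enlarging the union of the initial
  segments.\<close>
lemma eligible_iff:
  assumes x: "x \<in> {1..k} \<rightarrow>\<^sub>E {0..n}"
  shows "x \<in> eligible n k \<pi> \<longleftrightarrow> (\<forall>i\<in>{1..k}. x i < n \<longrightarrow> inv (perm1 \<pi> i) (x i + 1) \<notin> U x)"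
proof -
  have "(perm2 \<pi> i j (x i + 1) \<ge> x j + 1) \<longleftrightarrow> inv (perm1 \<pi> i) (x i + 1) \<notin> P j (x j)"
    if "i \<in> {1..k}" "x i < n" for i j
    using inv_permutes_in[OF perm1_permutes[OF pi that(1)], of "x i + 1"] that(2)
    by (auto simp: perm2_def perm_prefix_def not_le Suc_le_eq)
  then show ?thesis using x unfolding eligible_def tuple_union_def by simp
qed

lemma longest_prefixes_in_PiE: "G A \<in> {1..k} \<rightarrow>\<^sub>E {0..n}"
  using longest_prefixes_le by (intro PiE_I) (auto simp: longest_prefixes_def)

lemma tuple_union_longest_prefixes_subset: "U (G A) \<subseteq> A"
  unfolding tuple_union_def by (intro UN_least) (simp add: longest_prefixes_iff longest_prefixes_le)

text \<open>If the next element of the \<open>i\<close>-th order were already in the union, the \<open>i\<close>-th segment inside \<open>A\<close> would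
  not be the longest one.\<close>
lemma longest_prefixes_eligible: "G A \<in> eligible n k \<pi>"
  unfolding eligible_iff[OF longest_prefixes_in_PiE]
proof (intro ballI impI notI)
  fix i assume i: "i \<in> {1..k}" "G A i < n" and e: "inv (perm1 \<pi> i) (G A i + 1) \<in> U (G A)"
  have "P i (G A i + 1) = insert (inv (perm1 \<pi> i) (G A i + 1)) (P i (G A i))"
    using perm_prefix_Suc(1)[OF perm1_permutes[OF pi i(1)], of "G A i + 1"] i(2) by simp
  moreover have "P i (G A i) \<subseteq> A" using longest_prefixes_iff[OF i(1)] i(2) by simp
  ultimately have "P i (G A i + 1) \<subseteq> A" using e tuple_union_longest_prefixes_subset[of A] by auto
  then have "G A i + 1 \<le> G A i" using longest_prefixes_iff[OF i(1), of "G A i + 1" A] i(2) by simp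
  then show False by simp
qed

lemma eligible_PiE: "x \<in> eligible n k \<pi> \<Longrightarrow> x \<in> {1..k} \<rightarrow>\<^sub>E {0..n}"
  by (simp add: eligible_def)

lemma eligible_le: "x \<in> eligible n k \<pi> \<Longrightarrow> j \<in> {1..k} \<Longrightarrow> x j \<le> n"
  using eligible_PiE PiE_mem by fastforce

lemma longest_prefixes_tuple_union:
  assumes x: "x \<in> eligible n k \<pi>"
  shows "G (U x) = x"
proof (rule extensionalityI[of _ "{1..k}"])
  show "G (U x) \<in> extensional {1..k}" by (simp add: longest_prefixes_def)
  show "x \<in> extensional {1..k}" using eligible_PiE[OF x] by (simp add: PiE_def)
  fix j assume j: "j \<in> {1..k}"
  have "P j (x j) \<subseteq> U x" using j by (auto simp: tuple_union_def)
  then have "x j \<le> G (U x) j" using longest_prefixes_iff[OF j eligible_le[OF x j]] by simp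
  moreover have "\<not> x j < G (U x) j"
  proof
    assume less: "x j < G (U x) j"
    then have n: "x j + 1 \<le> n" using longest_prefixes_le[OF j, of "U x"] by simp
    then have "P j (x j + 1) \<subseteq> U x" using longest_prefixes_iff[OF j n] less by simp
    then have "inv (perm1 \<pi> j) (x j + 1) \<in> U x"
      using perm_prefix_Suc(1)[OF perm1_permutes[OF pi j], of "x j + 1"] n by auto
    then show False using eligible_iff[OF eligible_PiE[OF x]] x j n by simp
  qed
  ultimately show "G (U x) j = x j" by simp
qed

lemma tuple_union_in_prefix_unions: "U x \<in> prefix_unions n k \<pi>"
  unfolding tuple_union_def by (rule Union_feasible) (use perm_prefix_in_prefix_unions in auto)

lemma tuple_union_longest_prefixes:
  assumes A: "A \<in> prefix_unions n k \<pi>" shows "U (G A) = A"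
proof
  show "A \<subseteq> U (G A)"
  proof
    fix e assume e: "e \<in> A"
    then obtain j where j: "j \<in> {1..k}" "P j (perm1 \<pi> j e) \<subseteq> A" and n: "e \<in> {1..n}"
      using A unfolding prefix_unions_def by blast
    have "perm1 \<pi> j e \<le> n" using permutes_in_image[OF perm1_permutes[OF pi j(1)], of e] n by simp
    then have "perm1 \<pi> j e \<le> G A j" using longest_prefixes_iff[OF j(1)] j(2) by simp
    then have "e \<in> P j (G A j)" using n by (simp add: perm_prefix_def)
    then show "e \<in> U (G A)" using j(1) by (auto simp: tuple_union_def)
  qed
qed (rule tuple_union_longest_prefixes_subset)

lemma tuple_le_iff:
  assumes "x \<in> eligible n k \<pi>" "y \<in> eligible n k \<pi>"
  shows "(\<forall>i\<in>{1..k}. x i \<le> y i) \<longleftrightarrow> U x \<subseteq> U y"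
proof
  assume "\<forall>i\<in>{1..k}. x i \<le> y i"
  then show "U x \<subseteq> U y" unfolding tuple_union_def by (intro UN_mono perm_prefix_mono) auto
next
  assume *: "U x \<subseteq> U y"
  show "\<forall>i\<in>{1..k}. x i \<le> y i"
  proof
    fix i assume i: "i \<in> {1..k}"
    have "P i (x i) \<subseteq> U y" using * i unfolding tuple_union_def by blast
    then have "x i \<le> G (U y) i" using longest_prefixes_iff[OF i eligible_le[OF assms(1) i]] by simp
    then show "x i \<le> y i" using longest_prefixes_tuple_union[OF assms(2)] by simp
  qed
qed

lemma longest_prefixes_prefix:
  assumes "i \<in> {1..k}" "m \<le> n" shows "G (P i m) i = m"
proof (rule antisym)
  have p: "perm1 \<pi> i permutes {1..n}" using perm1_permutes[OF pi assms(1)] .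
  show "m \<le> G (P i m) i" using longest_prefixes_iff[OF assms, of "P i m"] by simp
  show "G (P i m) i \<le> m"
    using longest_prefixes_iff[OF assms(1) longest_prefixes_le[OF assms(1)], of "P i m" "P i m"]
      perm_prefix_subset_iff[OF p longest_prefixes_le[OF assms(1)] assms(2)] by simp
qed

text \<open>Among the eligible tuples with \<open>i\<close>-th component \<open>m\<close>, the least one belongs to the set
  that is just the initial segment of length \<open>m\<close> of the \<open>i\<close>-th order.\<close>
lemma tuple_chain_iff:
  assumes i: "i \<in> {1..k}"
  shows "x \<in> tuple_chain n k \<pi> i \<longleftrightarrow> x \<in> eligible n k \<pi> \<and> U x = P i (x i)"
proof (intro iffI conjI)
  assume x: "x \<in> tuple_chain n k \<pi> i"
  then show el: "x \<in> eligible n k \<pi>" by (simp add: tuple_chain_def)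
  let ?y = "G (P i (x i))"
  have "x i = ?y i" using longest_prefixes_prefix[OF i eligible_le[OF el i]] by simp
  then have "\<forall>j\<in>{1..k}. x j \<le> ?y j"
    using x longest_prefixes_eligible by (auto simp: tuple_chain_def tuple_lattice_def)
  then have "U x \<subseteq> U ?y" using tuple_le_iff el longest_prefixes_eligible by blast
  moreover have "U ?y = P i (x i)"
    by (rule tuple_union_longest_prefixes[OF perm_prefix_in_prefix_unions[OF i]])
  moreover have "P i (x i) \<subseteq> U x" using i by (auto simp: tuple_union_def)
  ultimately show "U x = P i (x i)" by blast
next
  assume x: "x \<in> eligible n k \<pi> \<and> U x = P i (x i)"
  have "\<forall>j\<in>{1..k}. x j \<le> y j" if y: "y \<in> eligible n k \<pi>" "x i = y i" for y
  proof -
    have "U x = P i (y i)" using x y by simp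
    also have "\<dots> \<subseteq> U y" using i by (auto simp: tuple_union_def)
    finally show ?thesis using tuple_le_iff x y by blast
  qed
  then show "x \<in> tuple_chain n k \<pi> i" using x by (simp add: tuple_chain_def tuple_lattice_def)
qed

lemma tuple_system_representation:
  "prefix_representation n k \<pi> (tuple_lattice n k \<pi>, tuple_chain n k \<pi>) U"
  unfolding prefix_representation_def case_prod_conv
proof (intro conjI ballI)
  show "bij_betw U (carrier (tuple_lattice n k \<pi>)) (prefix_unions n k \<pi>)"
    using longest_prefixes_tuple_union tuple_union_longest_prefixes
      tuple_union_in_prefix_unions longest_prefixes_eligible
    by (intro bij_betw_byWitness[where f' = G]) (auto simp: tuple_lattice_def)
  show "x \<sqsubseteq>\<^bsub>tuple_lattice n k \<pi>\<^esub> y \<longleftrightarrow> U x \<subseteq> U y"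
    if "x \<in> carrier (tuple_lattice n k \<pi>)" "y \<in> carrier (tuple_lattice n k \<pi>)" for x y
    using tuple_le_iff[of x y] that by (simp add: tuple_lattice_def)
  fix j assume j: "j \<in> {1..k}"
  show "tuple_chain n k \<pi> j \<subseteq> carrier (tuple_lattice n k \<pi>)"
    by (auto simp: tuple_chain_def tuple_lattice_def)
  show "U ` tuple_chain n k \<pi> j = perm_prefix n (perm1 \<pi> j) ` {0..n}"
  proof (intro equalityI subsetI)
    fix A assume "A \<in> U ` tuple_chain n k \<pi> j"
    then show "A \<in> perm_prefix n (perm1 \<pi> j) ` {0..n}"
      using tuple_chain_iff[OF j] eligible_le[OF _ j] by auto
  next
    fix A assume "A \<in> perm_prefix n (perm1 \<pi> j) ` {0..n}"
    then obtain m where m: "m \<le> n" "A = P j m" by auto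
    have "U (G A) = A"
      unfolding m(2) by (rule tuple_union_longest_prefixes[OF perm_prefix_in_prefix_unions[OF j]])
    moreover have "G A j = m" unfolding m(2) by (rule longest_prefixes_prefix[OF j m(1)])
    ultimately have "G A \<in> tuple_chain n k \<pi> j" "U (G A) = A"
      using tuple_chain_iff[OF j] longest_prefixes_eligible m by simp_all
    then show "A \<in> U ` tuple_chain n k \<pi> j" by force
  qed
qed (simp add: tuple_lattice_def)

end

section \<open>Representing a join-distributive lattice by collapsed edges of a maximal chain\<close>

definition saturated_chain :: "'a gorder \<Rightarrow> (nat \<Rightarrow> 'a) \<Rightarrow> nat \<Rightarrow> bool" where
  "saturated_chain L c n \<longleftrightarrow> (\<forall>i\<le>n. c i \<in> carrier L) \<and> (\<forall>i<n. covers L (c i) (c (Suc i))) \<and>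
     (\<forall>x\<in>carrier L. c 0 \<sqsubseteq>\<^bsub>L\<^esub> x) \<and> (\<forall>x\<in>carrier L. x \<sqsubseteq>\<^bsub>L\<^esub> c n)"

text \<open>The elements of the chain are numbered by the number of smaller chain elements. An element strictly
  between two neighbours, and likewise \<open>c 0 \<sqinter> x\<close> and \<open>c n \<squnion> x\<close>, is comparable with the whole chain,
  hence belongs to it by maximality.\<close>
lemma maximal_chain_saturated:
  assumes "lattice L" "finite (carrier L)" "carrier L \<noteq> {}" "maximal_chain L C"
  obtains c n where "C = c ` {0..n}" "saturated_chain L c n"
proof -
  interpret lattice L by (rule assms(1))
  have chain: "chain_in L C" using assms(4) by (simp add: pred_on.maxchain_def)
  then have C: "C \<subseteq> carrier L" by (simp add: pred_on.chain_def)
  have comparable: "x = y \<or> x \<sqsubset>\<^bsub>L\<^esub> y \<or> y \<sqsubset>\<^bsub>L\<^esub> x" if "x \<in> C" "y \<in> C" for x y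
    using pred_on.chain_total[OF chain that] by auto
  have maximal: "x \<in> C" if x: "x \<in> carrier L" "\<And>y. y \<in> C \<Longrightarrow> x \<sqsubseteq>\<^bsub>L\<^esub> y \<or> y \<sqsubseteq>\<^bsub>L\<^esub> x" for x
  proof (rule ccontr)
    assume "x \<notin> C"
    have "chain_in L (insert x C)"
    proof (rule pred_on.chainI)
      show "insert x C \<subseteq> carrier L" using x C by simp
      fix y z assume "y \<in> insert x C" "z \<in> insert x C"
      then show "(\<lambda>x y. x \<sqsubset>\<^bsub>L\<^esub> y)\<^sup>=\<^sup>= y z \<or> (\<lambda>x y. x \<sqsubset>\<^bsub>L\<^esub> y)\<^sup>=\<^sup>= z y"
        using comparable[of y z] x(2)[of y] x(2)[of z] by (auto simp: lless_eq)
    qed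
    then show False using assms(4) \<open>x \<notin> C\<close> unfolding pred_on.maxchain_def by blast
  qed
  have fin: "finite C" using C assms(2) finite_subset by blast
  have "C \<noteq> {}" using maximal assms(3) by blast
  define rk where "rk x = card {y \<in> C. y \<sqsubset>\<^bsub>L\<^esub> x}" for x
  have rk_less: "rk x < rk y" if "x \<in> C" "y \<in> C" "x \<sqsubset>\<^bsub>L\<^esub> y" for x y
  proof -
    have "{z \<in> C. z \<sqsubset>\<^bsub>L\<^esub> x} \<subseteq> {z \<in> C. z \<sqsubset>\<^bsub>L\<^esub> y}"
    proof
      fix z assume z: "z \<in> {z \<in> C. z \<sqsubset>\<^bsub>L\<^esub> x}"
      then have "z \<sqsubset>\<^bsub>L\<^esub> y" using lless_trans[of z x y] that C by auto
      then show "z \<in> {z \<in> C. z \<sqsubset>\<^bsub>L\<^esub> y}" using z by simp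
    qed
    moreover have "x \<in> {z \<in> C. z \<sqsubset>\<^bsub>L\<^esub> y}" "x \<notin> {z \<in> C. z \<sqsubset>\<^bsub>L\<^esub> x}"
      using that by (auto simp: lless_eq)
    ultimately show ?thesis unfolding rk_def using fin by (intro psubset_card_mono) auto
  qed
  define n where "n = card C - 1"
  have n: "card C = Suc n" using fin \<open>C \<noteq> {}\<close> by (simp add: n_def card_gt_0_iff)
  have rk_le: "rk x \<le> n" if "x \<in> C" for x
  proof -
    have "{y \<in> C. y \<sqsubset>\<^bsub>L\<^esub> x} \<subset> C" using that by (auto simp: lless_eq)
    then have "rk x < card C" unfolding rk_def using fin by (intro psubset_card_mono)
    then show ?thesis using n by simp
  qed
  have inj: "inj_on rk C"
    using rk_less comparable by (intro inj_onI) (metis less_irrefl)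
  have "rk ` C \<subseteq> {0..n}" using rk_le by auto
  then have img: "rk ` C = {0..n}"
    using card_image[OF inj] n by (intro card_subset_eq) auto
  define c where "c = inv_into C rk"
  have c: "c i \<in> C" "rk (c i) = i" if "i \<le> n" for i
    using that img by (auto simp: c_def inv_into_into f_inv_into_f)
  have c_rk: "c (rk x) = x" if "x \<in> C" for x using that inj by (simp add: c_def)
  have C_eq: "C = c ` {0..n}"
  proof (intro equalityI subsetI)
    fix x assume "x \<in> C" then show "x \<in> c ` {0..n}" using c_rk[of x] rk_le[of x] by (intro image_eqI[of _ _ "rk x"]) auto
  next
    fix x assume "x \<in> c ` {0..n}" then show "x \<in> C" using c(1) by auto
  qed
  have le: "x \<sqsubseteq>\<^bsub>L\<^esub> y" if "x \<in> C" "y \<in> C" "rk x \<le> rk y" for x y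
  proof -
    have "\<not> y \<sqsubset>\<^bsub>L\<^esub> x" using rk_less[of y x] that by auto
    then show ?thesis using comparable[of x y] that C by (auto simp: lless_eq)
  qed
  have cc: "c i \<in> carrier L" if "i \<le> n" for i using c(1)[OF that] C by blast
  have "covers L (c i) (c (Suc i))" if i: "i < n" for i
    unfolding covers_def
  proof (intro conjI notI)
    show "c i \<in> carrier L" "c (Suc i) \<in> carrier L" using cc i by simp_all
    have "c i \<noteq> c (Suc i)" using c(2)[of i] c(2)[of "Suc i"] i by auto
    moreover have "c i \<sqsubseteq>\<^bsub>L\<^esub> c (Suc i)" using le c[of i] c[of "Suc i"] i by simp
    ultimately show "c i \<sqsubset>\<^bsub>L\<^esub> c (Suc i)" by (simp add: lless_eq)
    assume "\<exists>z\<in>carrier L. c i \<sqsubset>\<^bsub>L\<^esub> z \<and> z \<sqsubset>\<^bsub>L\<^esub> c (Suc i)"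
    then obtain z where z: "z \<in> carrier L" "c i \<sqsubset>\<^bsub>L\<^esub> z" "z \<sqsubset>\<^bsub>L\<^esub> c (Suc i)" by blast
    have "z \<in> C"
    proof (rule maximal[OF z(1)])
      fix y assume y: "y \<in> C"
      then have yc: "y \<in> carrier L" using C by blast
      show "z \<sqsubseteq>\<^bsub>L\<^esub> y \<or> y \<sqsubseteq>\<^bsub>L\<^esub> z"
      proof (cases "rk y \<le> i")
        case True
        then have "y \<sqsubseteq>\<^bsub>L\<^esub> c i" using le[OF y c(1)[of i]] c(2)[of i] i by simp
        then show ?thesis using z yc cc[of i] i le_trans[of y "c i" z] by (simp add: lless_eq)
      next
        case False
        then have "c (Suc i) \<sqsubseteq>\<^bsub>L\<^esub> y" using le[OF c(1)[of "Suc i"] y] c(2)[of "Suc i"] i by simp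
        then show ?thesis using z yc cc[of "Suc i"] i le_trans[of z "c (Suc i)" y] by (simp add: lless_eq)
      qed
    qed
    then show False using rk_less[of "c i" z] rk_less[of z "c (Suc i)"] c[of i] c[of "Suc i"] z i by simp
  qed
  moreover have "c 0 \<sqsubseteq>\<^bsub>L\<^esub> x" if x: "x \<in> carrier L" for x
  proof -
    let ?z = "c 0 \<sqinter>\<^bsub>L\<^esub> x"
    have z: "?z \<in> carrier L" "?z \<sqsubseteq>\<^bsub>L\<^esub> c 0" using x cc meet_left by auto
    have "?z \<in> C"
    proof (rule maximal[OF z(1)])
      fix y assume y: "y \<in> C"
      then have "c 0 \<sqsubseteq>\<^bsub>L\<^esub> y" using le[OF c(1)[of 0] y] c(2)[of 0] by simp
      then show "?z \<sqsubseteq>\<^bsub>L\<^esub> y \<or> y \<sqsubseteq>\<^bsub>L\<^esub> ?z" using z y C cc[of 0] le_trans[of ?z "c 0" y] by auto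
    qed
    then have "c 0 \<sqsubseteq>\<^bsub>L\<^esub> ?z" using le[OF c(1)[of 0]] c(2)[of 0] by simp
    then show ?thesis using le_trans[of "c 0" ?z x] meet_right[of "c 0" x] x cc z by simp
  qed
  moreover have "x \<sqsubseteq>\<^bsub>L\<^esub> c n" if x: "x \<in> carrier L" for x
  proof -
    let ?z = "c n \<squnion>\<^bsub>L\<^esub> x"
    have z: "?z \<in> carrier L" "c n \<sqsubseteq>\<^bsub>L\<^esub> ?z" using x cc join_left by auto
    have "?z \<in> C"
    proof (rule maximal[OF z(1)])
      fix y assume y: "y \<in> C"
      then have "y \<sqsubseteq>\<^bsub>L\<^esub> c n" using le[OF y c(1)[of n]] c(2)[of n] rk_le by simp
      then show "?z \<sqsubseteq>\<^bsub>L\<^esub> y \<or> y \<sqsubseteq>\<^bsub>L\<^esub> ?z" using z y C cc[of n] le_trans[of y "c n" ?z] by auto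
    qed
    then have "?z \<sqsubseteq>\<^bsub>L\<^esub> c n" using le[OF _ c(1)[of n]] c(2)[of n] rk_le by simp
    then show ?thesis using le_trans[of x ?z "c n"] join_right[of "c n" x] x cc z by simp
  qed
  ultimately have "saturated_chain L c n" using cc by (simp add: saturated_chain_def)
  then show thesis using that C_eq by blast
qed

locale join_distributive_chain = lattice L for L :: "'a gorder" (structure) +
  fixes c :: "nat \<Rightarrow> 'a" and n :: nat
  assumes finite_L: "finite (carrier L)"
    and semimodular_L: "semimodular L"
    and meet_semidistributive_L: "meet_semidistributive L"
    and saturated: "saturated_chain L c n"
begin

lemma c_closed: "i \<le> n \<Longrightarrow> c i \<in> carrier L"
  and c_covers: "i < n \<Longrightarrow> covers L (c i) (c (Suc i))"
  and c_bottom: "x \<in> carrier L \<Longrightarrow> c 0 \<sqsubseteq> x"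
  and c_top: "x \<in> carrier L \<Longrightarrow> x \<sqsubseteq> c n"
  using saturated by (simp_all add: saturated_chain_def)

lemma coversD:
  assumes "covers L x y"
  shows "x \<in> carrier L" "y \<in> carrier L" "x \<sqsubseteq> y" "x \<noteq> y"
    and "z \<in> carrier L \<Longrightarrow> x \<sqsubseteq> z \<Longrightarrow> z \<sqsubseteq> y \<Longrightarrow> z = x \<or> z = y"
  using assms by (auto simp: covers_def lless_eq)

lemma join_absorb: "x \<in> carrier L \<Longrightarrow> y \<in> carrier L \<Longrightarrow> x \<sqsubseteq> y \<Longrightarrow> x \<squnion> y = y"
  by (metis le_iff_join le_iff_meet join_comm)

lemma join_mono:
  assumes "x \<in> carrier L" "y \<in> carrier L" "z \<in> carrier L" "w \<in> carrier L" "x \<sqsubseteq> y" "z \<sqsubseteq> w"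
  shows "x \<squnion> z \<sqsubseteq> y \<squnion> w"
  using assms le_trans[of x y "y \<squnion> w"] le_trans[of z w "y \<squnion> w"]
  by (intro join_le) (auto intro: join_left join_right)

lemma c_le_Suc: "i < n \<Longrightarrow> c i \<sqsubseteq> c (Suc i)"
  using c_covers coversD(3) by blast

lemma c_mono: "i \<le> j \<Longrightarrow> j \<le> n \<Longrightarrow> c i \<sqsubseteq> c j"
proof (induction rule: dec_induct)
  case (step j)
  then show ?case using le_trans[of "c i" "c j" "c (Suc j)"] c_closed c_le_Suc by simp
qed (use c_closed in simp)

lemma join_chain_step:
  assumes "x \<in> carrier L" "i < n"
  shows "c i \<squnion> x = c (Suc i) \<squnion> x \<or> covers L (c i \<squnion> x) (c (Suc i) \<squnion> x)"
  using semimodular_L c_covers[OF assms(2)] c_closed assms unfolding semimodular_def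
  by (meson Suc_leI less_imp_le_nat)

text \<open>The number \<open>i\<close> stands for the edge from \<open>c (i - 1)\<close> to \<open>c i\<close>. The condition says that both ends have the
  same join with \<open>x\<close> (\<open>Suc_in_collapsed_iff\<close>).\<close>
definition collapsed :: "'a \<Rightarrow> nat set" where
  "collapsed x = {i \<in> {1..n}. c i \<sqsubseteq> c (i - 1) \<squnion> x}"

lemma collapsed_subset: "collapsed x \<subseteq> {1..n}" by (auto simp: collapsed_def)

lemma finite_collapsed: "finite (collapsed x)" by (simp add: collapsed_def)

lemma Suc_in_collapsed_iff:
  assumes "x \<in> carrier L" "i < n"
  shows "Suc i \<in> collapsed x \<longleftrightarrow> c i \<squnion> x = c (Suc i) \<squnion> x"
proof -
  have c: "c i \<in> carrier L" "c (Suc i) \<in> carrier L" "c i \<sqsubseteq> c (Suc i)"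
    using c_closed c_le_Suc assms by simp_all
  have "c (Suc i) \<sqsubseteq> c i \<squnion> x \<longleftrightarrow> c i \<squnion> x = c (Suc i) \<squnion> x"
  proof
    assume "c (Suc i) \<sqsubseteq> c i \<squnion> x"
    then have "c (Suc i) \<squnion> x \<sqsubseteq> c i \<squnion> x" using c assms join_right by (intro join_le) auto
    moreover have "c i \<squnion> x \<sqsubseteq> c (Suc i) \<squnion> x" using c assms by (intro join_mono) auto
    ultimately show "c i \<squnion> x = c (Suc i) \<squnion> x" using c assms by (intro le_antisym) auto
  next
    assume "c i \<squnion> x = c (Suc i) \<squnion> x"
    then show "c (Suc i) \<sqsubseteq> c i \<squnion> x" using c assms join_left by simp
  qed
  then show ?thesis using assms by (simp add: collapsed_def)
qed

lemma collapsed_eqI: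
  assumes "\<And>i. i < n \<Longrightarrow> Suc i \<in> collapsed x \<longleftrightarrow> Suc i \<in> A" "A \<subseteq> {1..n}"
  shows "collapsed x = A"
proof (rule Set.set_eqI)
  fix e show "e \<in> collapsed x \<longleftrightarrow> e \<in> A"
  proof (cases "e \<in> {1..n}")
    case True
    then obtain i where "e = Suc i" "i < n" by (cases e) auto
    then show ?thesis using assms(1) by simp
  next
    case False then show ?thesis using assms(2) collapsed_subset by blast
  qed
qed

lemma collapsed_mono:
  assumes "x \<in> carrier L" "y \<in> carrier L" "x \<sqsubseteq> y"
  shows "collapsed x \<subseteq> collapsed y"
proof
  fix i assume i: "i \<in> collapsed x"
  then have i': "i \<in> {1..n}" "c i \<sqsubseteq> c (i - 1) \<squnion> x" by (auto simp: collapsed_def)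
  then have c: "c i \<in> carrier L" "c (i - 1) \<in> carrier L" using c_closed by auto
  have "c (i - 1) \<squnion> x \<sqsubseteq> c (i - 1) \<squnion> y" using c assms by (intro join_mono) auto
  then have "c i \<sqsubseteq> c (i - 1) \<squnion> y"
    using le_trans[OF i'(2)] c assms by simp
  then show "i \<in> collapsed y" using i' by (simp add: collapsed_def)
qed

text \<open>If the edge from \<open>b = c (i - 1)\<close> to \<open>c i\<close> is collapsed neither by \<open>x\<close> nor by \<open>y\<close>, then \<open>c i\<close> has the
  same meet \<open>b\<close> with \<open>b \<squnion> x\<close> and with \<open>b \<squnion> y\<close>. By meet-semidistributivity it also has the meet \<open>b\<close>
  with their join, so \<open>x \<squnion> y\<close> does not collapse the edge.\<close>
lemma collapsed_join:
  assumes x: "x \<in> carrier L" and y: "y \<in> carrier L"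
  shows "collapsed (x \<squnion> y) = collapsed x \<union> collapsed y"
proof
  show "collapsed x \<union> collapsed y \<subseteq> collapsed (x \<squnion> y)"
    using collapsed_mono[of x "x \<squnion> y"] collapsed_mono[of y "x \<squnion> y"] x y join_left[of x y] join_right[of x y] by simp
  show "collapsed (x \<squnion> y) \<subseteq> collapsed x \<union> collapsed y"
  proof
    fix i assume "i \<in> collapsed (x \<squnion> y)"
    then have i: "i \<in> {1..n}" "c i \<sqsubseteq> c (i - 1) \<squnion> (x \<squnion> y)" by (auto simp: collapsed_def)
    let ?c = "c i" and ?b = "c (i - 1)"
    have c: "?c \<in> carrier L" "?b \<in> carrier L" "covers L ?b ?c"
      using i(1) c_closed c_covers[of "i - 1"] by auto
    have meet: "?c \<sqinter> (?b \<squnion> w) = ?b" if w: "w \<in> carrier L" "i \<notin> collapsed w" for w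
    proof -
      have "?b \<sqsubseteq> ?c \<sqinter> (?b \<squnion> w)"
        using c w coversD(3)[OF c(3)] join_left[of ?b w] by (intro meet_le) auto
      moreover have "?c \<sqinter> (?b \<squnion> w) \<sqsubseteq> ?c" using c w meet_left by simp
      ultimately have "?c \<sqinter> (?b \<squnion> w) = ?b \<or> ?c \<sqinter> (?b \<squnion> w) = ?c"
        using coversD(5)[OF c(3)] c w by simp
      moreover have "?c \<sqinter> (?b \<squnion> w) \<noteq> ?c"
      proof
        assume "?c \<sqinter> (?b \<squnion> w) = ?c"
        then have "?c \<sqsubseteq> ?b \<squnion> w" using meet_right[of ?c "?b \<squnion> w"] c w by simp
        then show False using w i(1) by (simp add: collapsed_def)
      qed
      ultimately show ?thesis by blast
    qed
    show "i \<in> collapsed x \<union> collapsed y"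
    proof (rule ccontr)
      assume "i \<notin> collapsed x \<union> collapsed y"
      then have "?c \<sqinter> (?b \<squnion> x) = ?b" "?c \<sqinter> (?b \<squnion> y) = ?b" using meet x y by simp_all
      then have "?c \<sqinter> ((?b \<squnion> x) \<squnion> (?b \<squnion> y)) = ?b"
        using meet_semidistributive_L c x y unfolding meet_semidistributive_def
        by (metis join_closed)
      moreover have "?c \<sqsubseteq> (?b \<squnion> x) \<squnion> (?b \<squnion> y)"
      proof -
        let ?j = "(?b \<squnion> x) \<squnion> (?b \<squnion> y)"
        have j: "?j \<in> carrier L" "?b \<squnion> x \<in> carrier L" "?b \<squnion> y \<in> carrier L" using c x y by simp_all
        have 1: "?b \<squnion> x \<sqsubseteq> ?j" "?b \<squnion> y \<sqsubseteq> ?j" using j join_left join_right by simp_all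
        have "?b \<sqsubseteq> ?j" using le_trans[OF join_left[of ?b x] 1(1)] c x j by simp
        moreover have "x \<sqsubseteq> ?j" using le_trans[OF join_right[of ?b x] 1(1)] c x j by simp
        moreover have "y \<sqsubseteq> ?j" using le_trans[OF join_right[of ?b y] 1(2)] c y j by simp
        ultimately have "?b \<squnion> (x \<squnion> y) \<sqsubseteq> ?j" using c x y j by (intro join_le) auto
        then show ?thesis using le_trans[OF i(2)] c x y j by simp
      qed
      ultimately have "?c \<sqsubseteq> ?b"
        using meet_le[of ?c ?c "(?b \<squnion> x) \<squnion> (?b \<squnion> y)"] c x y by simp
      then show False using coversD(3,4)[OF c(3)] c le_antisym by blast
    qed
  qed
qed

lemma join_bottom: "x \<in> carrier L \<Longrightarrow> c 0 \<squnion> x = x"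
  using join_absorb c_bottom c_closed by simp

lemma join_top: "x \<in> carrier L \<Longrightarrow> c n \<squnion> x = c n"
  using join_absorb[of x "c n"] c_top c_closed join_comm[of L x "c n"] by simp

text \<open>Descend along \<open>c\<close> from the top, where the joins with \<open>x\<close> and \<open>y\<close> agree, to the bottom, where they are
  \<open>x\<close> and \<open>y\<close>. Each step is collapsed for both, which preserves the agreement, or for none; in that case
  the join with \<open>y\<close> is squeezed between the two ends of a cover and differs from the upper one.\<close>
lemma collapsed_inj_below:
  assumes x: "x \<in> carrier L" and y: "y \<in> carrier L" and le: "x \<sqsubseteq> y" and eq: "collapsed x = collapsed y"
  shows "x = y"
proof -
  have "c i \<squnion> x = c i \<squnion> y" if "i \<le> n" for i
    using that
  proof (induction rule: inc_induct)
    case base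
    then show ?case using join_top x y by simp
  next
    case (step i)
    have c: "c i \<in> carrier L" "c (Suc i) \<in> carrier L" using c_closed step by simp_all
    show ?case
    proof (cases "Suc i \<in> collapsed x")
      case True
      then have "c i \<squnion> x = c (Suc i) \<squnion> x" "c i \<squnion> y = c (Suc i) \<squnion> y"
        using eq Suc_in_collapsed_iff[OF x] Suc_in_collapsed_iff[OF y] step by simp_all
      then show ?thesis using step.IH by simp
    next
      case False
      then have cov: "covers L (c i \<squnion> x) (c (Suc i) \<squnion> x)"
        using join_chain_step[OF x] Suc_in_collapsed_iff[OF x] step by blast
      have ne: "c i \<squnion> y \<noteq> c (Suc i) \<squnion> x"
        using False eq Suc_in_collapsed_iff[OF y] step by simp
      have "c i \<squnion> x \<sqsubseteq> c i \<squnion> y" using c x y le by (intro join_mono) auto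
      moreover have "c i \<squnion> y \<sqsubseteq> c (Suc i) \<squnion> y"
        using c y c_le_Suc step by (intro join_mono) auto
      ultimately show ?thesis using coversD(5)[OF cov, of "c i \<squnion> y"] ne c y step.IH by simp
    qed
  qed
  from this[of 0] show ?thesis using join_bottom x y by simp
qed

lemma collapsed_le_iff:
  assumes "x \<in> carrier L" "y \<in> carrier L"
  shows "x \<sqsubseteq> y \<longleftrightarrow> collapsed x \<subseteq> collapsed y"
proof
  assume "collapsed x \<subseteq> collapsed y"
  then have "collapsed y = collapsed (x \<squnion> y)" using collapsed_join[OF assms] by blast
  then have "y = x \<squnion> y" using assms join_right by (intro collapsed_inj_below) auto
  then show "x \<sqsubseteq> y" using join_left[of x y] assms by simp
qed (use collapsed_mono assms in blast)

text \<open>By semimodularity the joins of \<open>x\<close> and \<open>y\<close> with \<open>c i\<close> form a ladder whose rungs are covers up to some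
  index \<open>t\<close> and trivial afterwards. Below \<open>t\<close> an edge is collapsed on both sides or on none, since
  two successive covers do not fit into one; above \<open>t\<close> both sides agree. In between, the rung at
  \<open>t\<close> coincides with the next edge on the side of \<open>x\<close>, while the side of \<open>y\<close> collapses that edge.\<close>
lemma collapsed_cover:
  assumes cov: "covers L x y"
  shows "\<exists>e. e \<notin> collapsed x \<and> collapsed y = insert e (collapsed x)"
proof -
  note xy = coversD(1-4)[OF cov]
  have eq_up: "c (Suc i) \<squnion> x = c (Suc i) \<squnion> y" if "c i \<squnion> x = c i \<squnion> y" "i < n" for i
  proof -
    have "c (Suc i) \<squnion> z = c (Suc i) \<squnion> (c i \<squnion> z)" if z: "z \<in> carrier L" for z
    proof -
      have c: "c i \<in> carrier L" "c (Suc i) \<in> carrier L" using c_closed \<open>i < n\<close> by simp_all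
      have "c (Suc i) \<squnion> (c i \<squnion> z) \<sqsubseteq> c (Suc i) \<squnion> z"
        using c z c_le_Suc[OF \<open>i < n\<close>] join_left[of "c (Suc i)" z]
        by (intro join_le join_mono) auto
      moreover have "c (Suc i) \<squnion> z \<sqsubseteq> c (Suc i) \<squnion> (c i \<squnion> z)"
        using c z join_right by (intro join_mono) auto
      ultimately show ?thesis using c z by (intro le_antisym) auto
    qed
    then show ?thesis using that(1) xy by metis
  qed
  \<comment> \<open>The first trivial rung; it is not at \<open>0\<close>, where the rung is the cover of \<open>x\<close> by \<open>y\<close> itself.\<close>
  define t' where "t' = (LEAST i. c i \<squnion> x = c i \<squnion> y)"
  have top: "c n \<squnion> x = c n \<squnion> y" using join_top xy by simp
  have t': "c t' \<squnion> x = c t' \<squnion> y" "t' \<le> n"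
    unfolding t'_def by (rule LeastI[of _ n], rule top) (rule Least_le, rule top)
  have "t' \<noteq> 0" using t'(1) join_bottom xy by auto
  then obtain t where t: "t' = Suc t" by (cases t') auto
  have below: "c i \<squnion> x \<noteq> c i \<squnion> y" if "i \<le> t" for i
    using not_less_Least[of i "\<lambda>i. c i \<squnion> x = c i \<squnion> y"] that t by (simp add: t'_def)
  have above: "c i \<squnion> x = c i \<squnion> y" if "i > t" "i \<le> n" for i
  proof -
    have "Suc t \<le> i" using that by simp
    then show ?thesis using that(2)
      by (induction rule: dec_induct) (use t t'(1) eq_up in auto)
  qed
  have tn: "t < n" using t t' by simp
  have edge: "covers L (c i \<squnion> x) (c i \<squnion> y)" if "i \<le> t" for i
  proof -
    have "covers L (x \<squnion> c i) (y \<squnion> c i) \<or> x \<squnion> c i = y \<squnion> c i"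
      using semimodular_L cov xy c_closed[of i] that tn unfolding semimodular_def by simp
    then show ?thesis using below[OF that] by (simp add: join_comm)
  qed
  have "Suc t \<notin> collapsed x"
  proof
    assume "Suc t \<in> collapsed x"
    then have *: "c t \<squnion> x = c (Suc t) \<squnion> y" using Suc_in_collapsed_iff[OF xy(1) tn] t t'(1) by simp
    have "c t \<squnion> y \<sqsubseteq> c (Suc t) \<squnion> y"
      using c_closed tn xy c_le_Suc by (intro join_mono) auto
    then show False using * coversD[OF edge[of t]] le_antisym by auto
  qed
  moreover have "collapsed y = insert (Suc t) (collapsed x)"
  proof (rule collapsed_eqI)
    show "insert (Suc t) (collapsed x) \<subseteq> {1..n}" using collapsed_subset tn by auto
    fix i assume i: "i < n"
    have c: "c i \<in> carrier L" "c (Suc i) \<in> carrier L" "c i \<sqsubseteq> c (Suc i)"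
      using c_closed c_le_Suc i by simp_all
    have mono: "c i \<squnion> x \<sqsubseteq> c (Suc i) \<squnion> x" "c i \<squnion> y \<sqsubseteq> c (Suc i) \<squnion> y"
      "c (Suc i) \<squnion> x \<sqsubseteq> c (Suc i) \<squnion> y"
      using c xy by (auto intro!: join_mono)
    consider "i < t" | "i = t" | "i > t" by linarith
    then show "Suc i \<in> collapsed y \<longleftrightarrow> Suc i \<in> insert (Suc t) (collapsed x)"
    proof cases
      case 1
      have "Suc i \<in> collapsed x" if "Suc i \<in> collapsed y"
      proof -
        have "c (Suc i) \<squnion> x \<sqsubseteq> c i \<squnion> y" using mono(3) that Suc_in_collapsed_iff[OF xy(2) i] by simp
        then have "c (Suc i) \<squnion> x = c i \<squnion> x \<or> c (Suc i) \<squnion> x = c i \<squnion> y"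
          using coversD(5)[OF edge[of i], of "c (Suc i) \<squnion> x"] mono(1) c xy 1 by simp
        moreover have "c (Suc i) \<squnion> x \<noteq> c i \<squnion> y"
          using below[of "Suc i"] 1 that Suc_in_collapsed_iff[OF xy(2) i] by simp
        ultimately show ?thesis using Suc_in_collapsed_iff[OF xy(1) i] by simp
      qed
      then show ?thesis using 1 collapsed_mono[OF xy(1-3)] by auto
    next
      case 2
      have e: "c (Suc i) \<squnion> x = c (Suc i) \<squnion> y" using above[of "Suc i"] 2 i by simp
      have "covers L (c i \<squnion> x) (c (Suc i) \<squnion> x)"
        using join_chain_step[OF xy(1) i] \<open>Suc t \<notin> collapsed x\<close> Suc_in_collapsed_iff[OF xy(1) i] 2 by blast
      then have "c i \<squnion> y = c i \<squnion> x \<or> c i \<squnion> y = c (Suc i) \<squnion> x"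
        using coversD(3)[OF edge[of i]] mono(2) e 2 c xy
        by (intro coversD(5)) auto
      then have "c i \<squnion> y = c (Suc i) \<squnion> y" using below[of i] 2 e by auto
      then show ?thesis using Suc_in_collapsed_iff[OF xy(2) i] 2 by simp
    next
      case 3
      then show ?thesis
        using above[of i] above[of "Suc i"] i Suc_in_collapsed_iff[OF xy(1) i] Suc_in_collapsed_iff[OF xy(2) i] by simp
    qed
  qed
  ultimately show ?thesis by blast
qed

lemma collapsed_chain: 
  assumes "i \<le> n" shows "collapsed (c i) = {1..i}"
proof (rule collapsed_eqI)
  show "{1..i} \<subseteq> {1..n}" using assms by auto
  fix j assume j: "j < n"
  have c: "c i \<in> carrier L" "c j \<in> carrier L" "c (Suc j) \<in> carrier L" using c_closed assms j by simp_all
  have "Suc j \<in> collapsed (c i) \<longleftrightarrow> j < i"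
  proof (cases "j < i")
    case True
    then have "c j \<squnion> c i = c i" "c (Suc j) \<squnion> c i = c i"
      using c c_mono assms by (auto intro!: join_absorb)
    then show ?thesis using True Suc_in_collapsed_iff[OF c(1) j] by simp
  next
    case False
    then have "c i \<squnion> c j = c j" "c i \<squnion> c (Suc j) = c (Suc j)"
      using c c_mono[of i j] c_mono[of i "Suc j"] j by (auto intro!: join_absorb)
    then show ?thesis
      using False Suc_in_collapsed_iff[OF c(1) j] coversD(4)[OF c_covers[OF j]] by (simp add: join_comm)
  qed
  then show "Suc j \<in> collapsed (c i) \<longleftrightarrow> Suc j \<in> {1..i}" by auto
qed

lemma collapsed_inj: "inj_on collapsed (carrier L)"
  using collapsed_le_iff le_antisym by (intro inj_onI) blast

lemma Union_in_collapsed_image: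
  assumes "G \<subseteq> collapsed ` carrier L" shows "\<Union>G \<in> collapsed ` carrier L"
proof -
  have "finite G" using assms finite_L finite_surj by blast
  then show ?thesis using assms
  proof (induction G)
    case empty
    show ?case using collapsed_chain[of 0] c_closed[of 0] by (intro image_eqI[of _ _ "c 0"]) auto
  next
    case (insert A G)
    then obtain x y where x: "x \<in> carrier L" "A = collapsed x" and y: "y \<in> carrier L" "\<Union>G = collapsed y"
      by auto
    then have "\<Union>(insert A G) = collapsed (x \<squnion> y)" using collapsed_join by simp
    then show ?case using x y by simp
  qed
qed

lemma lower_cover_exists:
  assumes x: "x \<in> carrier L" "x \<noteq> c 0"
  shows "\<exists>y. covers L y x"
proof -
  let ?B = "{y \<in> carrier L. y \<sqsubset> x}"
  have B: "finite ?B" "c 0 \<in> ?B"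
    using finite_L c_closed c_bottom x by (auto simp: lless_eq)
  \<comment> \<open>As \<open>collapsed\<close> is strictly monotone, a largest set belongs to a maximal element.\<close>
  obtain y where y: "y \<in> ?B" and max: "\<And>z. z \<in> ?B \<Longrightarrow> card (collapsed z) \<le> card (collapsed y)"
    using B obtains_MAX[of ?B "\<lambda>y. card (collapsed y)"] by (metis (no_types, lifting) Max_ge emptyE finite_imageI imageI)
  have "covers L y x" unfolding covers_def
  proof (intro conjI notI)
    assume "\<exists>z\<in>carrier L. y \<sqsubset> z \<and> z \<sqsubset> x"
    then obtain z where z: "z \<in> carrier L" "y \<sqsubset> z" "z \<sqsubset> x" by blast
    have "collapsed y \<subset> collapsed z"
      using z y collapsed_mono[of y z] inj_onD[OF collapsed_inj, of y z] by (auto simp: lless_eq)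
    then have "card (collapsed y) < card (collapsed z)" using finite_collapsed psubset_card_mono by blast
    then show False using max[of z] z by simp
  qed (use x y in auto)
  then show ?thesis by blast
qed

text \<open>An element that is not join-irreducible and not the bottom is the join of two of its lower covers, and
  joins become unions.\<close>
lemma collapsed_covered_by_Ji:
  assumes "x \<in> carrier L" "e \<in> collapsed x"
  shows "\<exists>y\<in>Ji L. e \<in> collapsed y \<and> collapsed y \<subseteq> collapsed x"
  using assms
proof (induction "card (collapsed x)" arbitrary: x rule: less_induct)
  case less
  show ?case
  proof (cases "x \<in> Ji L")
    case True then show ?thesis using less.prems by blast
  next
    case False
    have "x \<noteq> c 0" using less.prems collapsed_chain[of 0] by auto
    then obtain y where y: "covers L y x" using lower_cover_exists less.prems by blast
    then obtain z where z: "covers L z x" "z \<noteq> y" using False less.prems by (auto simp: Ji_def)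
    note yx = coversD[OF y] and zx = coversD[OF z(1)]
    have j: "y \<squnion> z \<sqsubseteq> x" "y \<sqsubseteq> y \<squnion> z" "z \<sqsubseteq> y \<squnion> z" "y \<squnion> z \<in> carrier L"
      using yx zx join_left join_right by (auto intro: join_le)
    have "y \<squnion> z \<noteq> y"
    proof
      assume "y \<squnion> z = y"
      then have "y = z \<or> y = x" using zx(5)[of y] j(3) yx by simp
      then show False using z(2) yx(4) by blast
    qed
    then have "y \<squnion> z = x" using yx(5)[OF j(4,2,1)] by blast
    then have collapsed_x: "collapsed x = collapsed y \<union> collapsed z" using collapsed_join yx(1) zx(1) by metis
    have smaller: "card (collapsed w) < card (collapsed x)" "collapsed w \<subseteq> collapsed x" if "covers L w x" for w
      using collapsed_cover[OF that] finite_collapsed[of w] by auto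
    obtain w where w: "covers L w x" "e \<in> collapsed w" using collapsed_x less.prems y z(1) by blast
    then obtain v where "v \<in> Ji L" "e \<in> collapsed v" "collapsed v \<subseteq> collapsed w"
      using less.hyps[OF smaller(1)[OF w(1)] coversD(1)[OF w(1)] w(2)] by blast
    then show ?thesis using smaller(2)[OF w(1)] by blast
  qed
qed

end

text \<open>Adding the elements of \<open>{1..n}\<close> one by one orders them by the time of their arrival.\<close>
lemma insertion_sequence_perm:
  fixes S :: "nat \<Rightarrow> nat set"
  assumes S0: "S 0 = {}" and Sn: "S n = {1..n}"
    and step: "\<And>i. i < n \<Longrightarrow> \<exists>e. e \<notin> S i \<and> S (Suc i) = insert e (S i)"
  shows "\<exists>p. p permutes {1..n} \<and> (\<forall>i\<le>n. S i = perm_prefix n p i)"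
proof -
  define p where "p e = (if e \<in> {1..n} then LEAST i. e \<in> S i else e)" for e
  have mono: "S i \<subseteq> S j" if "i \<le> j" "j \<le> n" for i j
    using that
  proof (induction rule: dec_induct)
    case (step j)
    then show ?case using assms(3)[of j] by auto
  qed simp
  have p_mem: "e \<in> S (p e)" "p e \<le> n" if "e \<in> {1..n}" for e
    using that Sn LeastI[of "\<lambda>i. e \<in> S i" n] Least_le[of "\<lambda>i. e \<in> S i" n] by (simp_all add: p_def)
  have p_le: "p e \<le> i" if "e \<in> {1..n}" "e \<in> S i" for e i
    using that Least_le[of "\<lambda>i. e \<in> S i" i] by (simp add: p_def)
  have S_eq: "S i = perm_prefix n p i" if "i \<le> n" for i
  proof (intro equalityI subsetI)
    fix e assume e: "e \<in> S i"
    then have "e \<in> {1..n}" using mono[OF that] Sn by auto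
    then show "e \<in> perm_prefix n p i" using p_le e by (simp add: perm_prefix_def)
  next
    fix e assume "e \<in> perm_prefix n p i"
    then have "e \<in> {1..n}" "p e \<le> i" by (auto simp: perm_prefix_def)
    then show "e \<in> S i" using p_mem mono[of "p e" i] that by blast
  qed
  have "p ` {1..n} = {1..n}"
  proof (intro equalityI subsetI)
    fix i assume "i \<in> p ` {1..n}"
    then obtain e where e: "e \<in> {1..n}" "i = p e" by blast
    have "p e \<noteq> 0" using p_mem(1)[OF e(1)] S0 by (metis empty_iff)
    then show "i \<in> {1..n}" using p_mem(2)[OF e(1)] e by simp
  next
    fix i assume i: "i \<in> {1..n}"
    then have "i - 1 < n" "Suc (i - 1) = i" by auto
    from step[OF this(1)] this(2) obtain e where e: "e \<notin> S (i - 1)" "S i = insert e (S (i - 1))" by auto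
    have en: "e \<in> {1..n}" using e mono[of i n] i Sn by auto
    have "p e \<le> i" using p_le[OF en] e by blast
    moreover have "\<not> p e \<le> i - 1"
      using e(1) p_mem(1)[OF en] mono[of "p e" "i - 1"] \<open>i - 1 < n\<close> by auto
    ultimately have "p e = i" by simp
    then show "i \<in> p ` {1..n}" using en by blast
  qed
  then have "bij_betw p {1..n} {1..n}" by (simp add: bij_betw_def eq_card_imp_inj_on)
  then have "p permutes {1..n}" by (rule bij_imp_permutes) (auto simp: p_def)
  then show ?thesis using S_eq by (intro exI[of _ p]) simp
qed

context join_distributive_chain
begin

lemma saturated_chain_perm:
  assumes "saturated_chain L d m"
  shows "m = n" and "\<exists>p. p permutes {1..n} \<and> (\<forall>i\<le>n. collapsed (d i) = perm_prefix n p i)"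
proof -
  have d: "\<And>i. i \<le> m \<Longrightarrow> d i \<in> carrier L" "\<And>i. i < m \<Longrightarrow> covers L (d i) (d (Suc i))"
    "d 0 \<sqsubseteq> c 0" "c n \<sqsubseteq> d m"
    using assms c_closed by (simp_all add: saturated_chain_def)
  have "d 0 = c 0" using d c_bottom c_closed by (intro le_antisym) auto
  then have d0: "collapsed (d 0) = {}" using collapsed_chain[of 0] by simp
  have "d m = c n" using d c_top c_closed by (intro le_antisym) auto
  then have dm: "collapsed (d m) = {1..n}" using collapsed_chain[of n] by simp
  have step: "\<exists>e. e \<notin> collapsed (d i) \<and> collapsed (d (Suc i)) = insert e (collapsed (d i))" if "i < m" for i
    using collapsed_cover d that by blast
  have "card (collapsed (d i)) = i" if "i \<le> m" for i
    using that
  proof (induction i)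
    case (Suc i)
    then obtain e where "e \<notin> collapsed (d i)" "collapsed (d (Suc i)) = insert e (collapsed (d i))"
      using step[of i] by auto
    then show ?case using Suc finite_collapsed by simp
  qed (simp add: d0)
  from this[of m] show "m = n" using dm by simp
  then show "\<exists>p. p permutes {1..n} \<and> (\<forall>i\<le>n. collapsed (d i) = perm_prefix n p i)"
    using insertion_sequence_perm[of "\<lambda>i. collapsed (d i)" n] d0 dm step by simp
qed

text \<open>The first order is the natural one because \<open>collapsed (c i) = {1..i}\<close>. That the chains contain the
  join-irreducible elements is what makes every set in the image a union of initial segments.\<close>
lemma chains_representation:
  assumes k: "k \<ge> 1" and C1: "C 1 = c ` {0..n}"
    and C: "\<And>j. j \<in> {1..k} \<Longrightarrow> \<exists>d m. C j = d ` {0..m} \<and> saturated_chain L d m"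
    and Ji: "Ji L \<subseteq> (\<Union>j\<in>{1..k}. C j)"
  shows "\<exists>\<pi>\<in>perm_tuples n k. prefix_representation n k \<pi> (L, C) collapsed"
proof -
  have ex: "\<exists>p. p permutes {1..n} \<and> C j \<subseteq> carrier L \<and> collapsed ` C j = perm_prefix n p ` {0..n}"
    if j: "j \<in> {1..k}" for j
  proof -
    obtain d m where d: "C j = d ` {0..m}" "saturated_chain L d m" using C[OF j] by blast
    have m: "m = n" by (rule saturated_chain_perm(1)[OF d(2)])
    obtain p where p: "p permutes {1..n}" "\<forall>i\<le>n. collapsed (d i) = perm_prefix n p i"
      using saturated_chain_perm(2)[OF d(2)] by blast
    have "collapsed ` C j = perm_prefix n p ` {0..n}"
      unfolding d(1) m image_image by (rule image_cong) (use p in auto)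
    moreover have "C j \<subseteq> carrier L" using d by (auto simp: saturated_chain_def)
    ultimately show ?thesis using p(1) by blast
  qed
  then obtain q where q: "\<And>j. j \<in> {1..k} \<Longrightarrow> q j permutes {1..n} \<and> C j \<subseteq> carrier L \<and>
      collapsed ` C j = perm_prefix n (q j) ` {0..n}"
    by metis
  define \<pi> where "\<pi> = (\<lambda>j\<in>{2..k}. q j)"
  have pi: "\<pi> \<in> perm_tuples n k" using q by (auto simp: \<pi>_def perm_tuples_def)
  have CL: "C j \<subseteq> carrier L" if "j \<in> {1..k}" for j using q[OF that] by blast
  have collapsed_C: "collapsed ` C j = perm_prefix n (perm1 \<pi> j) ` {0..n}" if j: "j \<in> {1..k}" for j
  proof (cases "j = 1")
    case True
    have "collapsed ` C 1 = perm_prefix n id ` {0..n}"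
      unfolding C1 image_image by (rule image_cong) (auto simp: collapsed_chain perm_prefix_def)
    then show ?thesis using True by (simp add: perm1_def)
  next
    case False
    then show ?thesis using q[OF j] j by (simp add: \<pi>_def perm1_def)
  qed
  have "collapsed ` carrier L = prefix_unions n k \<pi>"
  proof (intro equalityI subsetI)
    fix A assume "A \<in> collapsed ` carrier L"
    then obtain x where x: "x \<in> carrier L" "A = collapsed x" by blast
    have "\<exists>j\<in>{1..k}. perm_prefix n (perm1 \<pi> j) (perm1 \<pi> j e) \<subseteq> A" if e: "e \<in> A" for e
    proof -
      obtain y where y: "y \<in> Ji L" "e \<in> collapsed y" "collapsed y \<subseteq> collapsed x"
        using collapsed_covered_by_Ji[OF x(1)] e x(2) by blast
      obtain j where j: "j \<in> {1..k}" "y \<in> C j" using y(1) Ji by blast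
      have "collapsed y \<in> perm_prefix n (perm1 \<pi> j) ` {0..n}" using collapsed_C[OF j(1)] j(2) by blast
      then obtain m where m: "collapsed y = perm_prefix n (perm1 \<pi> j) m" by blast
      then have "perm1 \<pi> j e \<le> m" using y(2) by (simp add: perm_prefix_def)
      then have "perm_prefix n (perm1 \<pi> j) (perm1 \<pi> j e) \<subseteq> A"
        using perm_prefix_mono[of "perm1 \<pi> j e" m n "perm1 \<pi> j"] m y(3) x(2) by simp
      then show ?thesis using j(1) by blast
    qed
    moreover have "A \<subseteq> {1..n}" using x(2) collapsed_subset by simp
    ultimately show "A \<in> prefix_unions n k \<pi>" by (simp add: prefix_unions_def)
  next
    fix A assume A: "A \<in> prefix_unions n k \<pi>"
    have "A = \<Union>{B \<in> collapsed ` carrier L. B \<subseteq> A}"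
    proof (intro equalityI subsetI)
      fix e assume e: "e \<in> A"
      then obtain j where j: "j \<in> {1..k}" and sub: "perm_prefix n (perm1 \<pi> j) (perm1 \<pi> j e) \<subseteq> A"
        and en: "e \<in> {1..n}"
        using A unfolding prefix_unions_def by blast
      have "perm1 \<pi> j e \<in> {0..n}"
        using permutes_in_image[OF perm1_permutes[OF pi j], of e] en by simp
      then have "perm_prefix n (perm1 \<pi> j) (perm1 \<pi> j e) \<in> collapsed ` C j" using collapsed_C[OF j] by blast
      then have "perm_prefix n (perm1 \<pi> j) (perm1 \<pi> j e) \<in> collapsed ` carrier L" using CL[OF j] by blast
      moreover have "e \<in> perm_prefix n (perm1 \<pi> j) (perm1 \<pi> j e)" using en by (simp add: perm_prefix_def)
      ultimately show "e \<in> \<Union>{B \<in> collapsed ` carrier L. B \<subseteq> A}" using sub by blast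
    qed blast
    then show "A \<in> collapsed ` carrier L" using Union_in_collapsed_image[of "{B \<in> collapsed ` carrier L. B \<subseteq> A}"] by simp
  qed
  then have "prefix_representation n k \<pi> (L, C) collapsed"
    unfolding prefix_representation_def case_prod_conv
    using collapsed_inj collapsed_le_iff CL collapsed_C eq_is_equal by (simp add: bij_betw_def)
  then show ?thesis using pi by blast
qed

end

text \<open>The first chain yields a representation with its own length \<open>m\<close> in place of \<open>n\<close>. A represented
  lattice has length \<open>m\<close>, whence \<open>m = n\<close>.\<close>
lemma JD_system_representation:
  assumes JD: "JD_system n k (L, C)" and n: "n \<ge> 1" and k: "k \<ge> 1"
  shows "\<exists>\<pi>\<in>perm_tuples n k. \<exists>\<phi>. prefix_representation n k \<pi> (L, C) \<phi>"
proof -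
  have L: "lattice L" "finite (carrier L)" "semimodular L" "meet_semidistributive L"
    and len: "lattice_length L = enat n"
    and C: "\<And>j. j \<in> {1..k} \<Longrightarrow> maximal_chain L (C j)"
    and Ji: "Ji L \<subseteq> (\<Union>j\<in>{1..k}. C j)"
    using JD unfolding JD_system_def join_distributive_def case_prod_conv by blast+
  have ne: "carrier L \<noteq> {}"
  proof
    assume "carrier L = {}"
    then have empty: "{C. chain_in L C \<and> finite C \<and> C \<noteq> {}} = {}"
      by (auto simp: pred_on.chain_def)
    \<comment> \<open>The supremum of no lengths is \<open>0\<close>, whereas \<open>n \<ge> 1\<close>.\<close>
    have "lattice_length L = 0" unfolding lattice_length_def empty by (simp add: bot_enat_def)
    then show False using len n by (simp add: zero_enat_def)
  qed
  have sat: "\<exists>d m. C j = d ` {0..m} \<and> saturated_chain L d m" if "j \<in> {1..k}" for j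
    using maximal_chain_saturated[OF L(1,2) ne C[OF that]] by metis
  obtain c m where c: "C 1 = c ` {0..m}" "saturated_chain L c m" using sat[of 1] k by auto
  interpret join_distributive_chain L c m
    using L c by (intro join_distributive_chain.intro join_distributive_chain_axioms.intro) auto
  obtain \<pi> where pi: "\<pi> \<in> perm_tuples m k" "prefix_representation m k \<pi> (L, C) collapsed"
    using chains_representation[OF k c(1) sat Ji] by blast
  have "lattice_length L = enat m"
    using representation_JD_system[OF pi(2,1) k] by (simp add: JD_system_def)
  then have "m = n" using len by simp
  then show ?thesis using pi by blast
qed

section \<open>The two maps\<close>

text \<open>An infinite type contains a copy of the finite family of feasible sets.\<close>
lemma representation_exists:
  assumes "infinite (UNIV :: 'a set)" "\<pi> \<in> perm_tuples n k"
  shows "\<exists>(S :: 'a chain_system) \<phi>. prefix_representation n k \<pi> S \<phi>"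
proof -
  interpret antimatroid "{1..n}" "prefix_unions n k \<pi>"
    by (rule antimatroid_prefix_unions[OF assms(2)])
  obtain B :: "'a set" where B: "finite B" "card B = card (prefix_unions n k \<pi>)"
    using infinite_arbitrarily_large[OF assms(1)] by blast
  then obtain g where g: "bij_betw g B (prefix_unions n k \<pi>)"
    using finite_same_card_bij[OF B(1) finite_family] by blast
  define L :: "'a gorder" where "L = \<lparr>carrier = B, eq = (=), le = (\<lambda>x y. g x \<subseteq> g y)\<rparr>"
  define C where "C j = {x \<in> B. g x \<in> perm_prefix n (perm1 \<pi> j) ` {0..n}}" for j
  have "g ` C j = perm_prefix n (perm1 \<pi> j) ` {0..n}" if j: "j \<in> {1..k}" for j
  proof -
    have "perm_prefix n (perm1 \<pi> j) ` {0..n} \<subseteq> g ` B"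
      using g perm_prefix_in_prefix_unions[OF j] by (auto simp: bij_betw_def)
    moreover have "g ` C j = g ` B \<inter> perm_prefix n (perm1 \<pi> j) ` {0..n}"
      unfolding C_def by (rule equalityI) (auto simp only: image_iff Int_iff mem_Collect_eq)
    ultimately show ?thesis by (simp add: Int_absorb1)
  qed
  moreover have "C j \<subseteq> B" for j by (auto simp: C_def)
  ultimately have "prefix_representation n k \<pi> (L, C) g"
    unfolding prefix_representation_def case_prod_conv using g by (simp add: L_def)
  then show ?thesis by (intro exI[where x = "(L, C)"] exI[where x = g])
qed

theorem theorem5p2:
  fixes n k :: nat
  assumes "n \<ge> 1" and "k \<ge> 2"
    and "infinite (UNIV :: 'a set)"
  shows "(\<forall>S :: 'a chain_system. JD_system n k S \<longrightarrow>
            xi n k (iso_class k S :: 'a chain_system set) = system_perms n k S)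
       \<and> bij_betw (xi n k) (JD n k :: 'a chain_system set set) (perm_tuples n k)
       \<and> bij_betw (eta n k) (perm_tuples n k) (JD n k :: 'a chain_system set set)
       \<and> (\<forall>X \<in> (JD n k :: 'a chain_system set set). eta n k (xi n k X) = X)
       \<and> (\<forall>\<pi> \<in> perm_tuples n k. xi n k (eta n k \<pi> :: 'a chain_system set) = \<pi>)"
proof -
  have k: "k \<ge> 1" using assms(2) by simp
  define R :: "(nat \<Rightarrow> nat \<Rightarrow> nat) \<Rightarrow> 'a chain_system set"
    where "R \<pi> = {S. \<exists>\<phi>. prefix_representation n k \<pi> S \<phi>}" for \<pi>
  have R_D: "JD_system n k S" "system_perms n k S = \<pi>" "iso_class k S = R \<pi>"
    if pi: "\<pi> \<in> perm_tuples n k" and S: "S \<in> R \<pi>" for \<pi> and S :: "'a chain_system"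
  proof -
    obtain L C \<phi> where "S = (L, C)" and r: "prefix_representation n k \<pi> (L, C) \<phi>"
      using S by (cases S) (auto simp: R_def)
    then show "JD_system n k S" "system_perms n k S = \<pi>" "iso_class k S = R \<pi>"
      using representation_JD_system[OF r pi k] representation_system_perms[OF r pi k]
        iso_class_eq_representable[OF r pi] by (simp_all add: R_def)
  qed
  have ex: "\<exists>\<pi>\<in>perm_tuples n k. S \<in> R \<pi>" if "JD_system n k S" for S :: "'a chain_system"
    using JD_system_representation[OF _ assms(1) k] that by (cases S) (auto simp: R_def)
  have ne: "R \<pi> \<noteq> {}" if "\<pi> \<in> perm_tuples n k" for \<pi>
    using representation_exists[OF assms(3) that] by (auto simp: R_def)
  have eta: "eta n k \<pi> = R \<pi>" if "\<pi> \<in> perm_tuples n k" for \<pi>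
    unfolding eta_def R_def
    by (rule iso_class_eq_representable[OF tuple_system_representation[OF that] that])
  have xi: "xi n k (R \<pi>) = \<pi>" if "\<pi> \<in> perm_tuples n k" for \<pi>
    unfolding xi_def using R_D(2)[OF that] ne[OF that] by (simp add: some_in_eq)
  have JD: "JD n k = R ` perm_tuples n k"
  proof (intro equalityI subsetI)
    fix X :: "'a chain_system set" assume "X \<in> JD n k"
    then obtain S :: "'a chain_system" where S: "X = iso_class k S" "JD_system n k S"
      by (auto simp: JD_def)
    then obtain \<pi> where "\<pi> \<in> perm_tuples n k" "S \<in> R \<pi>" using ex by blast
    then show "X \<in> R ` perm_tuples n k" using R_D(3) S(1) by blast
  next
    fix X assume "X \<in> R ` perm_tuples n k"
    then obtain \<pi> where pi: "\<pi> \<in> perm_tuples n k" "X = R \<pi>" by blast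
    then obtain S where S: "S \<in> R \<pi>" using ne by blast
    then show "X \<in> JD n k" unfolding JD_def using R_D(1,3)[OF pi(1) S] pi(2) by blast
  qed
  show ?thesis
  proof (intro conjI allI ballI impI)
    fix S :: "'a chain_system" assume "JD_system n k S"
    then obtain \<pi> where "\<pi> \<in> perm_tuples n k" "S \<in> R \<pi>" using ex by blast
    then show "xi n k (iso_class k S :: 'a chain_system set) = system_perms n k S"
      using R_D(2,3) xi by simp
  next
    show "bij_betw (xi n k) (JD n k :: 'a chain_system set set) (perm_tuples n k)"
      by (rule bij_betw_byWitness[where f' = R]) (auto simp: JD xi)
    show "bij_betw (eta n k) (perm_tuples n k) (JD n k :: 'a chain_system set set)"
      by (rule bij_betw_byWitness[where f' = "xi n k"]) (auto simp: JD xi eta)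
  qed (auto simp: JD xi eta)
qed

end
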